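(* Let $n\ge1$ be an integer, let $\mathfrak h_n$ be the $(2n+1)$-dimensional Heisenberg Lie algebra with its standard basis $y_1,\ldots,y_{2n},z$, and let $h$ be the inner product on $\mathfrak h_n$ with respect to which this basis is orthonormal. Then the basic partition function of the metric pair $(\mathfrak h_n,h)$ is $$Z_{\mathfrak h_n,h}(s,t)=\sum_{k=0}^n\ \sum_{m=0}^{n-k}\ \sum_{j=0}^{\min(m,\,n-k-m)}N_{n,k,j}\ s^{(m-j)(n-k-m-j+1)}\,t^{2m+k},$$ where $N_{n,k,0}=2^k\binom{n}{k}$ and $$N_{n,k,j}=2^k\binom{n}{k,\,j,\,n-k-j}\,\frac{n-k-2j+1}{n-k-j+1}$$ whenever $j\ge1$.
   Context: Heisenberg Lie algebra: $\mathfrak h_n$ is the real Lie algebra with basis $y_1,\ldots,y_{2n},z$ whose bracket satisfies $[y_{2k-1},y_{2k}]=z$ for $k\in\{1,\ldots,n\}$, all other brackets of basis elements (up to antisymmetry) being zero. It is 2-step nilpotent, i.e. $[x,[y,w]]=0$ for all $x,y,w$. Cartan-Chevalley-Eilenberg complex: for a finite-dimensional real 2-step nilpotent Lie algebra $\mathfrak g$, $\mathcal C^\bullet(\mathfrak g)=\bigwedge^\bullet\mathfrak g^\vee$ is the exterior algebra of the dual, with differential $d$ the odd derivation determined by $d(\varphi)(x,y)=\varphi([x,y])$ for $\varphi\in\mathfrak g^\vee$, $x,y\in\mathfrak g$. The subalgebra $\mathcal C^\bullet_B(\mathfrak g)=\bigwedge^\bullet H^1(\mathfrak g)\subseteq\mathcal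 C^\bullet(\mathfrak g)$ is the exterior algebra on $H^1(\mathfrak g)=\{\varphi\in\mathfrak g^\vee:[\mathfrak g,\mathfrak g]\subseteq\ker\varphi\}$. Basic Laplacian: a metric pair $(\mathfrak g,g)$ consists of a finite-dimensional 2-step nilpotent Lie algebra $\mathfrak g$ and a positive definite inner product $g$ on its underlying vector space (no compatibility with the bracket is required). The inner product induces one on $\mathcal C^\bullet(\mathfrak g)$, for which the wedge monomials in the dual of a $g$-orthonormal basis are orthonormal. Let $d^*$ be the adjoint of $d$ with respect to it and $\Delta=dd^*+d^*d$. The basic Laplacian $\Delta_B$ is the restriction of $\Delta$ to $\mathcal C^\bullet_B(\mathfrak g)$. Explicitly, if $\{y_1,\ldots,y_b,z_1,\ldots,z_c\}$ is an orthonormal basis of $\mathfrak g$ such that $\{z_1,\ldots,z_c\}$ is a basis of $[\mathfrak g,\mathfrak g]$ and $[y_i,y_j]=\sum_{k}\gamma_{i,j}^kz_k$, then $\mathcal C^\bullet_B(\mathfrak g)$ consists of the polynomials in the anticommuting dual variables $y_1^*,\ldots,y_b^*$ and $$\Delta_B=\sum_{k=1}^c\sum_{1\le i<j\le b}\sum_{1\le r<l\le b}\gamma_{i,j}^k\gamma_{r,l}^k\,y_r^*y_l^*\frac{\partial}{\partial y_j^*}\frac{\partial}{\partial y_i^*}.$$ Basic partition function: $Z_{\mathfrak g,g}(s,t)=\mathrm{Tr}(s^{\Delta_B}t^{\deg})$, the trace taken over $\mathcal C^\bullet_B(\mathfrak g)$, where $\deg\omega=m\omega$ for $\omega$ homogeneous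 of degree $m$. That is, $Z_{\mathfrak g,g}(s,t)=\sum_m\sum_\lambda s^\lambda t^m$, where for each $m$ the inner sum runs over the eigenvalues $\lambda$ (with multiplicity) of $\Delta_B$ on the degree-$m$ part of $\mathcal C^\bullet_B(\mathfrak g)$, with $s^0=1$. $\binom{n}{k,\,j,\,n-k-j}=\frac{n!}{k!\,j!\,(n-k-j)!}$ denotes the multinomial coefficient. *)

theory Defs
  imports "HOL-Analysis.Analysis"
begin

text \<open>
  A metric pair is presented in an orthonormal basis: the Lie algebra is \<open>real ^ 'i\<close> with the
  standard inner product and a bracket \<open>br\<close>, which need not be adapted to the inner product.
\<close>

type_synonym 'i vect = "(real, 'i) vec"
type_synonym 'i bracket = "'i vect \<Rightarrow> 'i vect \<Rightarrow> 'i vect"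
type_synonym 'i cochain = "(real, 'i set) vec"

definition lie_bracket :: "'i::finite bracket \<Rightarrow> bool" where
  "lie_bracket br \<longleftrightarrow>
     bilinear br \<and> (\<forall>x. br x x = 0) \<and>
     (\<forall>x y w. br x (br y w) + br y (br w x) + br w (br x y) = 0)"

definition two_step_nilpotent :: "'i::finite bracket \<Rightarrow> bool" where
  "two_step_nilpotent br \<longleftrightarrow> (\<forall>x y w. br x (br y w) = 0)"

text \<open>
  The vectors \<open>y 1, \<dots>, y (2 * n), z\<close> enumerate the standard basis of \<open>real ^ 'i\<close>, so that this basis
  is orthonormal and \<open>CARD('i) = 2 * n + 1\<close>. Only the values of \<open>y\<close> on \<open>{1..2 * n}\<close> matter.
\<close>

definition heisenberg ::
    "nat \<Rightarrow> 'i::finite bracket \<Rightarrow> (nat \<Rightarrow> 'i vect) \<Rightarrow> 'i vect \<Rightarrow> bool" where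
  "heisenberg n br y z \<longleftrightarrow>
     lie_bracket br \<and>
     z \<in> Basis \<and> bij_betw y {1..2 * n} (Basis - {z}) \<and>
     (\<forall>k\<in>{1..n}. br (y (2 * k - 1)) (y (2 * k)) = z) \<and>
     (\<forall>a\<in>{1..2 * n}. \<forall>b\<in>{1..2 * n}.
        a < b \<and> \<not> (\<exists>k\<in>{1..n}. a = 2 * k - 1 \<and> b = 2 * k) \<longrightarrow> br (y a) (y b) = 0) \<and>
     (\<forall>a\<in>{1..2 * n}. br (y a) z = 0)"


section \<open>The exterior algebra of the dual\<close>

text \<open>
  The exterior algebra of the dual of \<open>real ^ 'i\<close> is \<open>real ^ ('i set)\<close>: for \<open>S = {i\<^sub>1 < \<dots> < i\<^sub>m}\<close> the
  vector \<open>axis S 1\<close> stands for the monomial \<open>e\<^sub>i\<^sub>1\<^sup>* \<and> \<dots> \<and> e\<^sub>i\<^sub>m\<^sup>*\<close> in the dual basis. These monomials are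
  orthonormal for the inner product of \<open>real ^ ('i set)\<close>. The order on \<open>'i\<close> only fixes signs.
\<close>

definition shuffle_sign :: "'i::linorder set \<Rightarrow> 'i set \<Rightarrow> real" where
  "shuffle_sign A B = (- 1) ^ card {(a, b). a \<in> A \<and> b \<in> B \<and> b < a}"

definition wedge ::
    "'i::{finite,linorder} cochain \<Rightarrow> 'i cochain \<Rightarrow> 'i cochain" where
  "wedge \<omega> \<eta> = (\<chi> S. \<Sum>T\<in>Pow S. shuffle_sign T (S - T) * \<omega> $ T * \<eta> $ (S - T))"

definition homogeneous :: "nat \<Rightarrow> 'i::finite cochain \<Rightarrow> bool" where
  "homogeneous m \<omega> \<longleftrightarrow> (\<forall>S. \<omega> $ S \<noteq> 0 \<longrightarrow> card S = m)"

definition covector :: "('i vect \<Rightarrow> real) \<Rightarrow> 'i::finite cochain" where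
  "covector \<phi> = (\<Sum>i\<in>UNIV. \<phi> (axis i 1) *\<^sub>R axis {i} 1)"

text \<open>
  The value of the degree 2 part of \<open>\<omega>\<close> at a pair of vectors, normalised by
  \<open>(\<phi> \<and> \<psi>)(x, y) = \<phi> x * \<psi> y - \<phi> y * \<psi> x\<close>.
\<close>

definition eval2 :: "'i::{finite,linorder} cochain \<Rightarrow> 'i vect \<Rightarrow> 'i vect \<Rightarrow> real" where
  "eval2 \<omega> x y = (\<Sum>(i, j) | i < j. \<omega> $ {i, j} * (x $ i * y $ j - x $ j * y $ i))"


section \<open>The Cartan-Chevalley-Eilenberg differential and the Laplacian\<close>

definition odd_derivation ::
    "('i::{finite,linorder} cochain \<Rightarrow> 'i cochain) \<Rightarrow> bool" where
  "odd_derivation D \<longleftrightarrow>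
     linear D \<and>
     (\<forall>m \<omega> \<eta>. homogeneous m \<omega> \<longrightarrow>
        D (wedge \<omega> \<eta>) = wedge (D \<omega>) \<eta> + (- 1) ^ m *\<^sub>R wedge \<omega> (D \<eta>))"

definition is_ce_differential ::
    "'i bracket \<Rightarrow>
     ('i::{finite,linorder} cochain \<Rightarrow> 'i cochain) \<Rightarrow> bool" where
  "is_ce_differential br D \<longleftrightarrow>
     odd_derivation D \<and>
     (\<forall>\<phi>. linear \<phi> \<longrightarrow>
        homogeneous 2 (D (covector \<phi>)) \<and>
        (\<forall>x y. eval2 (D (covector \<phi>)) x y = \<phi> (br x y)))"

definition ce_d ::
    "'i bracket \<Rightarrow>
     'i::{finite,linorder} cochain \<Rightarrow> 'i cochain" where
  "ce_d br = (THE D. is_ce_differential br D)"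

definition laplacian ::
    "'i bracket \<Rightarrow>
     'i::{finite,linorder} cochain \<Rightarrow> 'i cochain" where
  "laplacian br \<omega> = ce_d br (adjoint (ce_d br) \<omega>) + adjoint (ce_d br) (ce_d br \<omega>)"


section \<open>Basic cochains and the basic partition function\<close>

definition H1 :: "'i::finite bracket \<Rightarrow> ('i vect \<Rightarrow> real) set" where
  "H1 br = {\<phi>. linear \<phi> \<and> span {br x y | x y. True} \<subseteq> {v. \<phi> v = 0}}"

definition ext_subalgebra :: "'i::{finite,linorder} cochain set \<Rightarrow> bool" where
  "ext_subalgebra A \<longleftrightarrow>
     subspace A \<and> axis {} 1 \<in> A \<and> (\<forall>\<omega>\<in>A. \<forall>\<eta>\<in>A. wedge \<omega> \<eta> \<in> A)"

definition basic_cochains ::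
    "'i bracket \<Rightarrow> 'i::{finite,linorder} cochain set" where
  "basic_cochains br = ext_subalgebra hull (covector ` H1 br)"

definition basic_eigenspace ::
    "'i bracket \<Rightarrow> nat \<Rightarrow> real \<Rightarrow>
     'i::{finite,linorder} cochain set" where
  "basic_eigenspace br m \<mu> =
     {\<omega> \<in> basic_cochains br. homogeneous m \<omega> \<and> laplacian br \<omega> = \<mu> *\<^sub>R \<omega>}"

definition basic_eigenvalues ::
    "'i::{finite,linorder} bracket \<Rightarrow> nat \<Rightarrow> real set" where
  "basic_eigenvalues br m = {\<mu>. \<exists>\<omega>\<in>basic_eigenspace br m \<mu>. \<omega> \<noteq> 0}"

text \<open>
  The value at \<open>\<mu> = 0\<close> is 1 also for \<open>s = 0\<close>, where \<open>0 powr 0 = 0\<close>. For \<open>\<mu> = of_nat k\<close> this is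
  the ordinary power \<open>s ^ k\<close>, for every complex \<open>s\<close>.
\<close>

definition real_exp_power :: "complex \<Rightarrow> real \<Rightarrow> complex" where
  "real_exp_power s \<mu> = (if \<mu> = 0 then 1 else s powr of_real \<mu>)"

text \<open>
  The Laplacian is self-adjoint, so the multiplicity of an eigenvalue is the dimension of its
  eigenspace.
\<close>

definition basic_partition_function ::
    "'i::{finite,linorder} bracket \<Rightarrow> complex \<Rightarrow> complex \<Rightarrow> complex" where
  "basic_partition_function br s t =
     (\<Sum>m\<le>CARD('i). \<Sum>\<mu>\<in>basic_eigenvalues br m.
        of_nat (dim (basic_eigenspace br m \<mu>)) * real_exp_power s \<mu> * t ^ m)"

definition heisenberg_multiplicity :: "nat \<Rightarrow> nat \<Rightarrow> nat \<Rightarrow> real" where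
  "heisenberg_multiplicity n k j =
     (if j = 0 then 2 ^ k * real (n choose k)
      else 2 ^ k * (fact n / (fact k * fact j * fact (n - k - j))) *
        ((real n - real k - 2 * real j + 1) / (real n - real k - real j + 1)))"


section \<open>Existence and uniqueness of the differential\<close>

abbreviation (input) mon :: "'i set \<Rightarrow> 'i::{finite,linorder} cochain" where
  "mon S \<equiv> axis S 1"

lemma shuffle_sign_Un_left:
  fixes A B C :: "'i::{finite,linorder} set"
  assumes "A \<inter> B = {}"
  shows "shuffle_sign (A \<union> B) C = shuffle_sign A C * shuffle_sign B C"
proof -
  have "{(a, b). a \<in> A \<union> B \<and> b \<in> C \<and> b < a} =
      {(a, b). a \<in> A \<and> b \<in> C \<and> b < a} \<union> {(a, b). a \<in> B \<and> b \<in> C \<and> b < a}" by auto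
  moreover have "card ({(a, b). a \<in> A \<and> b \<in> C \<and> b < a} \<union> {(a, b). a \<in> B \<and> b \<in> C \<and> b < a}) =
      card {(a, b). a \<in> A \<and> b \<in> C \<and> b < a} + card {(a, b). a \<in> B \<and> b \<in> C \<and> b < a}"
    using assms by (intro card_Un_disjoint) auto
  ultimately show ?thesis by (simp add: shuffle_sign_def power_add)
qed

lemma shuffle_sign_Un_right:
  fixes A B C :: "'i::{finite,linorder} set"
  assumes "A \<inter> B = {}"
  shows "shuffle_sign C (A \<union> B) = shuffle_sign C A * shuffle_sign C B"
proof -
  have "{(a, b). a \<in> C \<and> b \<in> A \<union> B \<and> b < a} =
      {(a, b). a \<in> C \<and> b \<in> A \<and> b < a} \<union> {(a, b). a \<in> C \<and> b \<in> B \<and> b < a}" by auto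
  moreover have "card ({(a, b). a \<in> C \<and> b \<in> A \<and> b < a} \<union> {(a, b). a \<in> C \<and> b \<in> B \<and> b < a}) =
      card {(a, b). a \<in> C \<and> b \<in> A \<and> b < a} + card {(a, b). a \<in> C \<and> b \<in> B \<and> b < a}"
    using assms by (intro card_Un_disjoint) auto
  ultimately show ?thesis by (simp add: shuffle_sign_def power_add)
qed

lemma shuffle_sign_swap:
  fixes A B :: "'i::{finite,linorder} set"
  assumes "A \<inter> B = {}"
  shows "shuffle_sign A B * shuffle_sign B A = (- 1) ^ (card A * card B)"
proof -
  define P Q where "P = {(a, b). a \<in> A \<and> b \<in> B \<and> b < a}"
    and "Q = {(b, a). b \<in> B \<and> a \<in> A \<and> a < b}"
  have "A \<times> B = P \<union> prod.swap ` Q"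
    using assms by (auto simp: P_def Q_def image_def)
  moreover have "card (P \<union> prod.swap ` Q) = card P + card (prod.swap ` Q)"
    by (rule card_Un_disjoint) (auto simp: P_def Q_def)
  moreover have "card (prod.swap ` Q) = card Q" by (rule card_image) (auto simp: inj_on_def)
  ultimately have "card A * card B = card P + card Q"
    by (simp flip: card_cartesian_product)
  then show ?thesis by (simp add: shuffle_sign_def P_def Q_def power_add)
qed

lemma shuffle_sign_square [simp]: "shuffle_sign A B * shuffle_sign A B = 1"
  by (simp add: shuffle_sign_def flip: power_mult_distrib)

lemma shuffle_sign_square' [simp]: "shuffle_sign A B * (shuffle_sign A B * c) = c"
  by (simp flip: mult.assoc)

lemma shuffle_sign_empty [simp]: "shuffle_sign {} A = 1" "shuffle_sign A {} = 1"
  by (auto simp: shuffle_sign_def)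

lemma cochain_expand: "\<omega> = (\<Sum>S\<in>UNIV. \<omega> $ S *\<^sub>R mon S)"
  by (simp add: vec_eq_iff axis_def if_distrib cong: if_cong)

lemma bilinear_wedge: "bilinear wedge"
  by (auto simp: bilinear_def linear_iff wedge_def vec_eq_iff algebra_simps sum.distrib
      sum_distrib_left)

lemmas wedge_add_left = bilinear_ladd[OF bilinear_wedge]
  and wedge_add_right = bilinear_radd[OF bilinear_wedge]
  and wedge_scale_left = bilinear_lmul[OF bilinear_wedge]
  and wedge_scale_right = bilinear_rmul[OF bilinear_wedge]
  and wedge_zero_left = bilinear_lzero[OF bilinear_wedge]
  and wedge_zero_right = bilinear_rzero[OF bilinear_wedge]

lemma wedge_sum_left: "wedge (sum f A) \<eta> = (\<Sum>a\<in>A. wedge (f a) \<eta>)"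
  using bilinear_wedge linear_sum[of "\<lambda>x. wedge x \<eta>"] by (auto simp: bilinear_def)

lemma wedge_sum_right: "wedge \<eta> (sum f A) = (\<Sum>a\<in>A. wedge \<eta> (f a))"
  using bilinear_wedge linear_sum by (auto simp: bilinear_def)

lemma wedge_mon:
  "wedge (mon S) (mon T) = (if S \<inter> T = {} then shuffle_sign S T *\<^sub>R mon (S \<union> T) else 0)"
proof -
  have "(\<Sum>A\<in>Pow U. shuffle_sign A (U - A) * mon S $ A * mon T $ (U - A)) =
      (if S \<inter> T = {} \<and> U = S \<union> T then shuffle_sign S T else 0)" for U
  proof -
    have "(\<Sum>A\<in>Pow U. shuffle_sign A (U - A) * mon S $ A * mon T $ (U - A)) =
        (\<Sum>A\<in>Pow U. if A = S then (if U - S = T then shuffle_sign S T else 0) else 0)"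
      by (intro sum.cong) (auto simp: axis_def)
    also have "\<dots> = (if S \<subseteq> U \<and> U - S = T then shuffle_sign S T else 0)"
      by (subst sum.delta) auto
    also have "S \<subseteq> U \<and> U - S = T \<longleftrightarrow> S \<inter> T = {} \<and> U = S \<union> T" by auto
    finally show ?thesis .
  qed
  then show ?thesis by (auto simp: wedge_def vec_eq_iff axis_def)
qed

lemma linear_wedge_left: "linear f \<Longrightarrow> linear (\<lambda>x. wedge (f x) \<eta>)"
  using linear_compose[of f "\<lambda>x. wedge x \<eta>"] bilinear_wedge unfolding bilinear_def o_def by blast

lemma linear_wedge_right: "linear f \<Longrightarrow> linear (\<lambda>x. wedge \<eta> (f x))"
  using linear_compose[of f "wedge \<eta>"] bilinear_wedge unfolding bilinear_def o_def by blast

lemma linear_eq_homogeneous: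
  fixes f g :: "'a::{finite,linorder} cochain \<Rightarrow> 'b::real_vector"
  assumes "linear f" "linear g" "homogeneous m \<omega>"
    and eq: "\<And>S. card S = m \<Longrightarrow> f (mon S) = g (mon S)"
  shows "f \<omega> = g \<omega>"
proof -
  have "(\<Sum>S\<in>UNIV. \<omega> $ S *\<^sub>R mon S) = (\<Sum>S | card S = m. \<omega> $ S *\<^sub>R mon S)"
    using assms(3) by (intro sum.mono_neutral_right) (auto simp: homogeneous_def)
  then have exp: "\<omega> = (\<Sum>S | card S = m. \<omega> $ S *\<^sub>R mon S)"
    using cochain_expand[of \<omega>] by simp
  have "h \<omega> = (\<Sum>S | card S = m. \<omega> $ S *\<^sub>R h (mon S))" if "linear h" for h :: "'a cochain \<Rightarrow> 'b"
    using arg_cong[OF exp, of h] by (simp add: linear_sum[OF that] linear_cmul[OF that])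
  from this[OF assms(1)] this[OF assms(2)] show ?thesis by (simp add: eq)
qed

lemma linear_eq_mon:
  fixes f g :: "'a::{finite,linorder} cochain \<Rightarrow> 'b::real_vector"
  assumes "linear f" "linear g" and eq: "\<And>S. f (mon S) = g (mon S)"
  shows "f \<omega> = g \<omega>"
proof -
  have "h \<omega> = (\<Sum>S\<in>UNIV. \<omega> $ S *\<^sub>R h (mon S))" if "linear h" for h :: "'a cochain \<Rightarrow> 'b"
    using arg_cong[OF cochain_expand[of \<omega>], of h]
    by (simp add: linear_sum[OF that] linear_cmul[OF that])
  from this[OF assms(1)] this[OF assms(2)] show ?thesis by (simp add: eq)
qed

lemma wedge_assoc_mon:
  "wedge (wedge (mon S) (mon T)) (mon U) = wedge (mon S) (wedge (mon T) (mon U))"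
  by (auto simp: wedge_mon wedge_scale_left wedge_scale_right wedge_zero_left wedge_zero_right
      Int_Un_distrib Int_Un_distrib2 Un_assoc shuffle_sign_Un_left shuffle_sign_Un_right)

lemma wedge_assoc: "wedge (wedge \<omega> \<eta>) \<theta> = wedge \<omega> (wedge \<eta> \<theta>)"
proof (rule linear_eq_mon[of "\<lambda>\<omega>. wedge (wedge \<omega> \<eta>) \<theta>"])
  fix S
  show "wedge (wedge (mon S) \<eta>) \<theta> = wedge (mon S) (wedge \<eta> \<theta>)"
  proof (rule linear_eq_mon[of "\<lambda>\<eta>. wedge (wedge (mon S) \<eta>) \<theta>"])
    fix T
    show "wedge (wedge (mon S) (mon T)) \<theta> = wedge (mon S) (wedge (mon T) \<theta>)"
      by (rule linear_eq_mon[of "\<lambda>\<theta>. wedge (wedge (mon S) (mon T)) \<theta>"])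
        (intro linear_wedge_left linear_wedge_right real_vector.linear_ident wedge_assoc_mon)+
  qed (intro linear_wedge_left linear_wedge_right real_vector.linear_ident)+
qed (intro linear_wedge_left linear_wedge_right real_vector.linear_ident)+

lemma wedge_one_left [simp]: "wedge (mon {}) \<omega> = \<omega>"
  by (rule linear_eq_mon[of "\<lambda>\<omega>. wedge (mon {}) \<omega>" "\<lambda>\<omega>. \<omega>"])
    (auto simp: wedge_mon intro: linear_wedge_right real_vector.linear_ident)

lemma wedge_one_right [simp]: "wedge \<omega> (mon {}) = \<omega>"
  by (rule linear_eq_mon[of "\<lambda>\<omega>. wedge \<omega> (mon {})" "\<lambda>\<omega>. \<omega>"])
    (auto simp: wedge_mon intro: linear_wedge_left real_vector.linear_ident)

lemma homogeneous_2_commute: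
  assumes "homogeneous 2 \<omega>"
  shows "wedge \<omega> \<eta> = wedge \<eta> \<omega>"
proof (rule linear_eq_homogeneous[OF _ _ assms, of "\<lambda>\<omega>. wedge \<omega> \<eta>"])
  fix S :: "'a set"
  assume S: "card S = 2"
  show "wedge (mon S) \<eta> = wedge \<eta> (mon S)"
  proof (rule linear_eq_mon[of "\<lambda>\<eta>. wedge (mon S) \<eta>"])
    fix T
    show "wedge (mon S) (mon T) = wedge (mon T) (mon S)"
    proof (cases "S \<inter> T = {}")
      case True
      have "shuffle_sign S T * shuffle_sign T S = 1"
        using shuffle_sign_swap[OF True] S by simp
      then have "shuffle_sign T S = shuffle_sign S T"
        by (metis mult.right_neutral shuffle_sign_square')
      then show ?thesis using True by (auto simp: wedge_mon Un_commute Int_commute)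
    qed (auto simp: wedge_mon Int_commute)
  qed (intro linear_wedge_left linear_wedge_right real_vector.linear_ident)+
qed (intro linear_wedge_left linear_wedge_right real_vector.linear_ident)+

text \<open>The odd derivation \<open>\<partial>/\<partial>e\<^sub>i\<^sup>*\<close>.\<close>

definition contract :: "'i \<Rightarrow> 'i::{finite,linorder} cochain \<Rightarrow> 'i cochain" where
  "contract i \<omega> = (\<chi> S. if i \<in> S then 0 else shuffle_sign {i} S * \<omega> $ insert i S)"

lemma linear_contract: "linear (contract i)"
  by (auto simp: linear_iff contract_def vec_eq_iff algebra_simps)

lemma contract_mon:
  "contract i (mon S) = (if i \<in> S then shuffle_sign {i} (S - {i}) *\<^sub>R mon (S - {i}) else 0)"
  by (auto simp: contract_def vec_eq_iff axis_def)

lemmas contract_scale = linear_cmul[OF linear_contract]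
  and contract_sum = linear_sum[OF linear_contract]
  and contract_zero = linear_0[OF linear_contract]

lemma contract_wedge_mon:
  "contract i (wedge (mon S) (mon T)) =
    wedge (contract i (mon S)) (mon T) + (- 1) ^ card S *\<^sub>R wedge (mon S) (contract i (mon T))"
proof -
  consider "i \<notin> S" "i \<notin> T" | "i \<in> S" "i \<notin> T" | "i \<notin> S" "i \<in> T" | "i \<in> S" "i \<in> T" by blast
  then show ?thesis
  proof cases
    case 1
    then show ?thesis
      by (simp add: wedge_mon contract_mon contract_scale contract_zero wedge_zero_left
          wedge_zero_right)
  next
    case 2
    then obtain R where S: "S = insert i R" "i \<notin> R" by (metis Set.set_insert)
    have eq: "insert i (R \<union> T) - {i} = R \<union> T" "insert i R - {i} = R" using S 2 by auto
    have sign: "shuffle_sign (insert i R) T = shuffle_sign {i} T * shuffle_sign R T"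
      using S shuffle_sign_Un_left[of "{i}" R T] by simp
    show ?thesis
    proof (cases "R \<inter> T = {}")
      case True
      then have "shuffle_sign {i} (R \<union> T) = shuffle_sign {i} R * shuffle_sign {i} T"
        by (rule shuffle_sign_Un_right)
      then show ?thesis
        using True 2
        by (simp add: S(1) wedge_mon contract_mon contract_scale wedge_zero_right wedge_scale_left
            eq sign mult_ac)
    qed (use 2 S in \<open>auto simp: wedge_mon contract_mon wedge_scale_left eq
        contract_zero wedge_zero_right\<close>)
  next
    case 3
    then obtain R where T: "T = insert i R" "i \<notin> R" by (metis Set.set_insert)
    have eq: "insert i (S \<union> R) - {i} = S \<union> R" "insert i R - {i} = R" using T 3 by auto
    have sign: "shuffle_sign S (insert i R) = shuffle_sign S {i} * shuffle_sign S R"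
      using T shuffle_sign_Un_right[of "{i}" R S] by simp
    have swap: "shuffle_sign S {i} * shuffle_sign {i} S = (- 1) ^ card S"
      using 3 shuffle_sign_swap[of S "{i}"] by simp
    show ?thesis
    proof (cases "S \<inter> R = {}")
      case True
      then have "shuffle_sign {i} (S \<union> R) = shuffle_sign {i} S * shuffle_sign {i} R"
        by (rule shuffle_sign_Un_right)
      then show ?thesis
        using True 3
        by (simp add: T(1) wedge_mon contract_mon contract_scale wedge_zero_left wedge_scale_right
            eq sign mult_ac flip: swap)
    qed (use 3 T in \<open>auto simp: wedge_mon contract_mon wedge_scale_right eq
        contract_zero wedge_zero_left\<close>)
  next
    case 4
    then obtain P R where S: "S = insert i P" "i \<notin> P" and T: "T = insert i R" "i \<notin> R"
      by (metis Set.set_insert)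
    have sign: "shuffle_sign P (insert i R) = shuffle_sign P {i} * shuffle_sign P R"
      "shuffle_sign (insert i P) R = shuffle_sign {i} R * shuffle_sign P R"
      using S T shuffle_sign_Un_right[of "{i}" R P] shuffle_sign_Un_left[of "{i}" P R] by simp_all
    have swap: "shuffle_sign P {i} * shuffle_sign {i} P = (- 1) ^ card P"
      using S shuffle_sign_swap[of P "{i}"] by simp
    have card: "card S = Suc (card P)" using S by simp
    have lhs: "contract i (wedge (mon S) (mon T)) = 0"
      using 4 by (auto simp: wedge_mon contract_zero)
    show ?thesis
    proof (cases "P \<inter> R = {}")
      case True
      have "shuffle_sign {i} P * shuffle_sign P T = (- 1) ^ card P * shuffle_sign P R"
        by (simp add: T(1) sign flip: swap)
      moreover have "shuffle_sign {i} R * shuffle_sign S R = shuffle_sign P R"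
        by (simp add: S(1) sign)
      moreover have "P \<inter> T = {}" "S \<inter> R = {}" "S \<union> R = P \<union> T" using True S T by auto
      moreover have "S - {i} = P" "T - {i} = R" using S T by auto
      ultimately show ?thesis
        unfolding lhs using 4 by (simp add: wedge_mon contract_mon wedge_scale_left
            wedge_scale_right card)
    next
      case False
      then have "P \<inter> T \<noteq> {}" "S \<inter> R \<noteq> {}" using S T by auto
      moreover have "S - {i} = P" "T - {i} = R" using S T by auto
      ultimately show ?thesis
        unfolding lhs using 4 by (simp add: wedge_mon contract_mon wedge_scale_left
            wedge_scale_right)
    qed
  qed
qed

lemma linear_contract_compose: "linear f \<Longrightarrow> linear (\<lambda>x. contract i (f x))"
  using linear_compose[of f "contract i"] linear_contract unfolding o_def by blast

lemma contract_wedge: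
  assumes "homogeneous m \<omega>"
  shows "contract i (wedge \<omega> \<eta>) =
    wedge (contract i \<omega>) \<eta> + (- 1) ^ m *\<^sub>R wedge \<omega> (contract i \<eta>)"
proof (rule linear_eq_homogeneous[OF _ _ assms, of "\<lambda>\<omega>. contract i (wedge \<omega> \<eta>)"])
  fix S :: "'a set"
  assume S: "card S = m"
  show "contract i (wedge (mon S) \<eta>) =
      wedge (contract i (mon S)) \<eta> + (- 1) ^ m *\<^sub>R wedge (mon S) (contract i \<eta>)"
    by (rule linear_eq_mon[of "\<lambda>\<eta>. contract i (wedge (mon S) \<eta>)"])
      (intro linear_wedge_left linear_wedge_right linear_contract_compose real_vector.linear_ident
        real_vector.linear_compose_add real_vector.linear_compose_scale_right contract_wedge_mon[of i S, unfolded S])+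
qed (intro linear_wedge_left linear_wedge_right linear_contract_compose real_vector.linear_ident
    real_vector.linear_compose_add real_vector.linear_compose_scale_right)+

text \<open>The differential of \<open>e\<^sub>i\<^sup>*\<close>, that is, component \<open>i\<close> of the bracket.\<close>

definition two_form :: "'i bracket \<Rightarrow> 'i::{finite,linorder} \<Rightarrow> 'i cochain" where
  "two_form br i =
     (\<Sum>(a, b) | a < b. br (axis a 1) (axis b 1) $ i *\<^sub>R axis {a, b} 1)"

definition ce_d_formula :: "'i bracket \<Rightarrow> 'i::{finite,linorder} cochain \<Rightarrow> 'i cochain" where
  "ce_d_formula br \<omega> = (\<Sum>i\<in>UNIV. wedge (two_form br i) (contract i \<omega>))"

lemma doubleton_eq_less: "a < b \<Longrightarrow> c < d \<Longrightarrow> {a, b} = {c, d} \<longleftrightarrow> a = c \<and> b = (d::'a::linorder)"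
  by (metis doubleton_eq_iff order_less_asym)

lemma two_form_nth: "a < b \<Longrightarrow> two_form br i $ {a, b} = br (axis a 1) (axis b 1) $ i"
proof -
  assume ab: "a < b"
  have "two_form br i $ {a, b} =
      (\<Sum>p | fst p < snd p. if p = (a, b) then br (axis a 1) (axis b 1) $ i else 0)"
    unfolding two_form_def sum_component
    using ab by (intro sum.cong) (auto simp: axis_def doubleton_eq_less split: if_splits)
  also have "\<dots> = br (axis a 1) (axis b 1) $ i"
    using ab by (subst sum.delta) auto
  finally show ?thesis .
qed

lemma homogeneous_two_form: "homogeneous 2 (two_form br i)"
proof (unfold homogeneous_def, intro allI impI)
  fix S assume "two_form br i $ S \<noteq> 0"
  then have "\<exists>p\<in>{p. fst p < snd p}. (br (axis (fst p) 1) (axis (snd p) 1) $ i *\<^sub>R mon {fst p, snd p}) $ S \<noteq> 0"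
    unfolding two_form_def sum_component case_prod_unfold by (rule contrapos_np) (simp add: sum.neutral)
  then show "card S = 2" by (auto simp: axis_def split: if_splits)
qed

lemma homogeneous_sum: "(\<And>i. i \<in> A \<Longrightarrow> homogeneous m (f i)) \<Longrightarrow> homogeneous m (sum f A)"
  unfolding homogeneous_def sum_component by (metis (mono_tags, lifting) sum.neutral)

lemma homogeneous_scale: "homogeneous m \<omega> \<Longrightarrow> homogeneous m (c *\<^sub>R \<omega>)"
  by (auto simp: homogeneous_def)

lemma ce_d_formula_covector:
  "ce_d_formula br (covector \<phi>) = (\<Sum>i\<in>UNIV. \<phi> (axis i 1) *\<^sub>R two_form br i)"
proof -
  have "contract i (covector \<phi>) = \<phi> (axis i 1) *\<^sub>R mon {}" for i
    unfolding covector_def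
    by (simp add: contract_sum contract_scale contract_mon if_distrib cong: if_cong)
  then show ?thesis by (simp add: ce_d_formula_def wedge_scale_right)
qed

lemma odd_derivation_ce_d_formula: "odd_derivation (ce_d_formula br)"
  unfolding odd_derivation_def
proof (intro conjI allI impI)
  show "linear (ce_d_formula br)"
    unfolding ce_d_formula_def
    by (intro real_vector.linear_compose_sum ballI linear_wedge_right linear_contract)
  fix m and \<omega> \<eta> :: "'a cochain"
  assume \<omega>: "homogeneous m \<omega>"
  have "wedge (two_form br i) (wedge \<omega> \<theta>) = wedge \<omega> (wedge (two_form br i) \<theta>)" for i \<theta>
    by (metis homogeneous_2_commute homogeneous_two_form wedge_assoc)
  then show "ce_d_formula br (wedge \<omega> \<eta>) =
      wedge (ce_d_formula br \<omega>) \<eta> + (- 1) ^ m *\<^sub>R wedge \<omega> (ce_d_formula br \<eta>)"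
    by (simp add: ce_d_formula_def contract_wedge[OF \<omega>] wedge_add_right wedge_scale_right
        wedge_assoc wedge_sum_left wedge_sum_right sum.distrib scaleR_sum_right)
qed

lemma eval2_eq_bilinear:
  assumes br: "bilinear br" "\<And>x. br x x = (0 :: real)"
    and coeff: "\<And>a b. a < b \<Longrightarrow> \<omega> $ {a, b} = br (axis a 1) (axis b 1)"
  shows "eval2 \<omega> x y = br x y"
proof -
  have alt: "br a b = - br b a" for a b
  proof -
    have "br (a + b) (a + b) = br a a + br a b + (br b a + br b b)"
      by (simp add: bilinear_ladd[OF br(1)] bilinear_radd[OF br(1)])
    then show ?thesis by (simp add: br(2) eq_neg_iff_add_eq_0)
  qed
  define f where "f = (\<lambda>(a, b). x $ a * y $ b * br (axis a 1) (axis b 1))"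
  have exp: "v = (\<Sum>i\<in>UNIV. v $ i *\<^sub>R axis i 1)" for v :: "'a vect"
    by (simp add: vec_eq_iff axis_def if_distrib cong: if_cong)
  have "br x y = (\<Sum>p\<in>UNIV. f p)"
    by (subst exp[of x], subst exp[of y])
      (simp add: bilinear_sum[OF br(1)] bilinear_lmul[OF br(1)] bilinear_rmul[OF br(1)] f_def
        case_prod_unfold mult_ac flip: UNIV_Times_UNIV)
  also have "UNIV = {(a, b). a < b} \<union> ({(a, b). b < a} \<union> {(a :: 'a, b). a = b})" by auto
  also have "sum f \<dots> = sum f {(a, b). a < b} + (sum f {(a, b). b < a} + sum f {(a, b). a = b})"
    by (subst sum.union_disjoint, simp, simp, force, subst sum.union_disjoint, simp, simp, force)
      simp
  also have "sum f {(a, b). a = b} = 0" by (intro sum.neutral) (auto simp: f_def br(2))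
  also have "sum f {(a, b). b < a} = sum (\<lambda>(a, b). f (b, a)) {(a, b). a < b}"
    by (rule sum.reindex_bij_witness[of _ prod.swap prod.swap]) auto
  also have "sum f {(a, b). a < b} + (\<dots> + 0) = eval2 \<omega> x y"
  proof -
    have "f (b, a) = - (x $ b * y $ a * br (axis a 1) (axis b 1))" for a b
      using alt[of "axis b 1" "axis a 1"] by (simp add: f_def)
    then show ?thesis
      by (simp add: eval2_def flip: sum.distrib)
        (auto intro!: sum.cong simp: coeff f_def algebra_simps)
  qed
  finally show ?thesis by simp
qed

lemma is_ce_differential_formula:
  assumes "bilinear br" "\<And>x. br x x = 0"
  shows "is_ce_differential br (ce_d_formula br)"
  unfolding is_ce_differential_def
proof (intro conjI allI impI odd_derivation_ce_d_formula)
  fix \<phi> :: "'a vect \<Rightarrow> real" and x y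
  assume \<phi>: "linear \<phi>"
  show "homogeneous 2 (ce_d_formula br (covector \<phi>))"
    unfolding ce_d_formula_covector
    by (intro homogeneous_sum homogeneous_scale homogeneous_two_form)
  show "eval2 (ce_d_formula br (covector \<phi>)) x y = \<phi> (br x y)"
  proof (rule eval2_eq_bilinear[of "\<lambda>x y. \<phi> (br x y)"])
    show "bilinear (\<lambda>x y. \<phi> (br x y))"
      using assms(1) linear_compose[OF _ \<phi>] unfolding bilinear_def o_def by blast
    show "\<phi> (br x x) = 0" for x by (simp add: assms(2) linear_0[OF \<phi>])
    show "ce_d_formula br (covector \<phi>) $ {a, b} = \<phi> (br (axis a 1) (axis b 1))"
      if "a < b" for a b
    proof -
      have exp: "v = (\<Sum>i\<in>UNIV. v $ i *\<^sub>R axis i 1)" for v :: "'a vect"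
        by (simp add: vec_eq_iff axis_def if_distrib cong: if_cong)
      have expand: "\<phi> v = (\<Sum>i\<in>UNIV. v $ i * \<phi> (axis i 1))" for v
        using arg_cong[OF exp[of v], of \<phi>]
        by (simp only: linear_sum[OF \<phi>] linear_cmul[OF \<phi>] real_scaleR_def)
      show ?thesis
        unfolding expand[of "br (axis a 1) (axis b 1)"]
        using that by (simp add: ce_d_formula_covector two_form_nth mult.commute)
    qed
  qed
qed

lemma eval2_axis: "a < b \<Longrightarrow> eval2 \<omega> (axis a 1) (axis b 1) = \<omega> $ {a, b}"
proof -
  assume ab: "a < b"
  have "eval2 \<omega> (axis a 1) (axis b 1) = (\<Sum>p | fst p < snd p. if p = (a, b) then \<omega> $ {a, b} else 0)"
    unfolding eval2_def case_prod_unfold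
    using ab by (intro sum.cong) (auto simp: axis_def)
  also have "\<dots> = \<omega> $ {a, b}" using ab by (subst sum.delta) auto
  finally show ?thesis .
qed

lemma is_ce_differential_unique:
  assumes D: "is_ce_differential br D" and E: "is_ce_differential br E"
  shows "D = E"
proof
  note lin = D[unfolded is_ce_differential_def odd_derivation_def, THEN conjunct1, THEN conjunct1]
    E[unfolded is_ce_differential_def odd_derivation_def, THEN conjunct1, THEN conjunct1]
  have leib: "F (wedge \<omega> \<eta>) = wedge (F \<omega>) \<eta> + (- 1) ^ m *\<^sub>R wedge \<omega> (F \<eta>)"
    if "is_ce_differential br F" "homogeneous m \<omega>" for F m \<omega> \<eta>
    using that by (auto simp: is_ce_differential_def odd_derivation_def)
  have one: "F (mon {}) = 0" if F: "is_ce_differential br F" for F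
  proof -
    have "homogeneous 0 (mon {} :: 'a cochain)" by (auto simp: homogeneous_def axis_def)
    from leib[OF F this, of "mon {}"] show ?thesis by simp
  qed
  have gen: "D (mon {i}) = E (mon {i})" for i
  proof -
    let ?\<phi> = "\<lambda>v :: 'a vect. v $ i"
    have \<phi>: "linear ?\<phi>" by (simp add: linear_iff)
    have cov: "covector ?\<phi> = mon {i}"
      by (simp add: covector_def axis_def if_distrib[where f="\<lambda>c. c *\<^sub>R _"] cong: if_cong)
    have hom: "homogeneous 2 (D (mon {i}))" "homogeneous 2 (E (mon {i}))"
      and ev: "eval2 (D (mon {i})) x y = eval2 (E (mon {i})) x y" for x y
      using D E \<phi> unfolding is_ce_differential_def cov[symmetric] by simp_all
    have "D (mon {i}) $ S = E (mon {i}) $ S" for S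
    proof (cases "card S = 2")
      case True
      then obtain a b where ab: "S = {a, b}" "a \<noteq> b" by (meson card_2_iff)
      then consider "a < b" | "b < a" by (meson linorder_neqE)
      then show ?thesis
      proof cases
        case 1
        then show ?thesis using ev[of "axis a 1" "axis b 1"] by (simp add: eval2_axis ab)
      next
        case 2
        then show ?thesis
          using ev[of "axis b 1" "axis a 1"] by (simp add: eval2_axis ab insert_commute)
      qed
    next
      case False
      then have "D (mon {i}) $ S = 0" "E (mon {i}) $ S = 0"
        using hom unfolding homogeneous_def by blast+
      then show ?thesis by simp
    qed
    then show ?thesis by (simp add: vec_eq_iff)
  qed
  have mon: "D (mon S) = E (mon S)" for S
  proof (induction "card S" arbitrary: S)
    case 0
    then show ?case using one[OF D] one[OF E] by simp
  next
    case (Suc k)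
    define i where "i = Min S"
    define R where "R = S - {i}"
    have ne: "S \<noteq> {}" using Suc(2) by auto
    have S: "S = insert i R" "i \<notin> R" using Min_in[OF finite ne] by (auto simp: i_def R_def)
    have "i < r" if "r \<in> R" for r
      using that Min_le[of S r] unfolding i_def R_def by (auto simp: less_le)
    then have empty: "{(a, b). a \<in> {i} \<and> b \<in> R \<and> b < a} = {}"
      using order_less_asym by blast
    have "shuffle_sign {i} R = 1" unfolding shuffle_sign_def empty by simp
    then have eq: "mon S = wedge (mon {i}) (mon R)" using S(2) by (simp add: S(1) wedge_mon)
    have "card R = k" using Suc(2) S(2) by (simp add: S(1))
    then have "D (mon R) = E (mon R)" by (intro Suc(1)) simp
    moreover have "homogeneous 1 (mon {i} :: 'a cochain)"
      by (auto simp: homogeneous_def axis_def split: if_splits)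
    ultimately show ?case unfolding eq by (simp add: leib[OF D] leib[OF E] gen)
  qed
  fix \<omega>
  show "D \<omega> = E \<omega>" by (rule linear_eq_mon[OF lin mon])
qed

theorem ce_d_eq_formula:
  assumes "bilinear br" "\<And>x. br x x = 0"
  shows "ce_d br = ce_d_formula br"
  unfolding ce_d_def
  using is_ce_differential_formula[OF assms] is_ce_differential_unique by blast

theorem is_ce_differential_ce_d:
  assumes "bilinear br" "\<And>x. br x x = 0"
  shows "is_ce_differential br (ce_d br)"
  using is_ce_differential_formula[OF assms] by (simp add: ce_d_eq_formula[OF assms])

lemma linear_ce_d:
  assumes "bilinear br" "\<And>x. br x x = 0"
  shows "linear (ce_d br)"
  using is_ce_differential_ce_d[OF assms] by (simp add: is_ce_differential_def odd_derivation_def)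

lemma laplacian_self_adjoint:
  assumes "bilinear br" "\<And>x. br x x = 0"
  shows "laplacian br \<omega> \<bullet> \<eta> = \<omega> \<bullet> laplacian br \<eta>"
  by (simp add: laplacian_def inner_add adjoint_clauses[OF linear_ce_d[OF assms]]
      flip: adjoint_works[OF linear_ce_d[OF assms]])

lemma finite_basic_eigenvalues:
  assumes "bilinear br" "\<And>x. br x x = 0"
  shows "finite (basic_eigenvalues br m)"
proof -
  have "\<forall>\<mu>\<in>basic_eigenvalues br m. \<exists>\<omega>. \<omega> \<noteq> 0 \<and> laplacian br \<omega> = \<mu> *\<^sub>R \<omega>"
    by (auto simp: basic_eigenvalues_def basic_eigenspace_def)
  then obtain f where f: "f \<mu> \<noteq> 0" "laplacian br (f \<mu>) = \<mu> *\<^sub>R f \<mu>"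
    if "\<mu> \<in> basic_eigenvalues br m" for \<mu>
    by metis
  have inj: "inj_on f (basic_eigenvalues br m)"
    by (rule inj_onI) (metis f scaleR_cancel_right)
  have "pairwise orthogonal (f ` basic_eigenvalues br m)"
    unfolding pairwise_def orthogonal_def
  proof (clarsimp)
    fix \<mu> \<nu>
    assume *: "\<mu> \<in> basic_eigenvalues br m" "\<nu> \<in> basic_eigenvalues br m" "f \<mu> \<noteq> f \<nu>"
    have "\<mu> * (f \<mu> \<bullet> f \<nu>) = \<nu> * (f \<mu> \<bullet> f \<nu>)"
      using laplacian_self_adjoint[OF assms, of "f \<mu>" "f \<nu>"] f * by simp
    with * show "f \<mu> \<bullet> f \<nu> = 0" by auto
  qed
  moreover have "0 \<notin> f ` basic_eigenvalues br m" using f by force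
  ultimately have "independent (f ` basic_eigenvalues br m)"
    by (rule pairwise_orthogonal_independent)
  then have "finite (f ` basic_eigenvalues br m)" by (rule independent_imp_finite)
  with inj show ?thesis by (simp add: finite_image_iff)
qed


section \<open>Powers with natural exponents\<close>

lemma real_exp_power_of_nat: "real_exp_power s (of_nat k) = s ^ k"
  by (cases "s = 0") (auto simp: real_exp_power_def powr_nat)


section \<open>The Heisenberg Lie algebras\<close>

lemma two_step_nilpotent_heisenberg:
  assumes h: "heisenberg n br y z"
  shows "two_step_nilpotent br"
proof -
  have bil: "bilinear br" and alt: "br x x = 0" for x
    using h by (auto simp: heisenberg_def lie_bracket_def)
  note lin = bil[unfolded bilinear_def]
  have anti: "br a b = - br b a" for a b
  proof -
    have "br (a + b) (a + b) = br a a + br a b + (br b a + br b b)"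
      by (simp add: bilinear_ladd[OF bil] bilinear_radd[OF bil])
    then show ?thesis by (simp add: alt eq_neg_iff_add_eq_0)
  qed
  have Basis: "Basis = insert z (y ` {1..2 * n})"
    using h by (auto simp: heisenberg_def bij_betw_def)
  have yz: "br (y a) z = 0" if "a \<in> {1..2 * n}" for a
    using h that by (auto simp: heisenberg_def)
  have center: "br x z = 0" for x
  proof -
    have "br b z = 0" if "b \<in> Basis" for b
      using that yz alt unfolding Basis by auto
    then have "(\<lambda>x. br x z) = (\<lambda>x. 0)"
      using lin by (intro linear_eq_stdbasis real_vector.linear_zero) auto
    then show ?thesis by metis
  qed
  have lt: "br (y a) (y b) \<in> {0, z}" if "a \<in> {1..2 * n}" "b \<in> {1..2 * n}" "a < b" for a b
    using h that unfolding heisenberg_def by blast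
  have "br u v \<in> {0, z, - z}" if uv: "u \<in> Basis" "v \<in> Basis" for u v
  proof (cases "u = z \<or> v = z")
    case True
    then show ?thesis using center anti[of z v] by auto
  next
    case False
    then obtain a b where ab: "u = y a" "v = y b" "a \<in> {1..2 * n}" "b \<in> {1..2 * n}"
      using uv unfolding Basis by auto
    consider "a < b" | "a = b" | "b < a" by linarith
    then show ?thesis
    proof cases
      case 1
      then show ?thesis using lt[of a b] ab by auto
    next
      case 2
      then show ?thesis using ab alt by auto
    next
      case 3
      then show ?thesis using lt[of b a] ab anti[of u v] by auto
    qed
  qed
  then have basis: "br x (br u v) = 0" if "u \<in> Basis" "v \<in> Basis" for x u v
    using that center[of x] bilinear_rzero[OF bil] bilinear_rneg[OF bil, of x z] by fastforce
  have "br x (br u w) = 0" for x u w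
  proof -
    have "(\<lambda>u w. br x (br u w)) = (\<lambda>u w. 0)"
    proof (rule bilinear_eq_stdbasis)
      show "bilinear (\<lambda>u w. br x (br u w))"
        using lin linear_compose[of _ "br x"] unfolding bilinear_def o_def by blast
    qed (auto simp: basis bilinear_def real_vector.linear_zero)
    then show ?thesis by metis
  qed
  then show ?thesis by (simp add: two_step_nilpotent_def)
qed

lemma ex_heisenberg:
  assumes "CARD('i::finite) = 2 * n + 1"
  shows "\<exists>br (y :: nat \<Rightarrow> 'i vect) z. heisenberg n br y z"
proof -
  obtain z :: "'i vect" where z: "z \<in> Basis" using nonempty_Basis by blast
  have "card (Basis - {z}) = 2 * n" using assms z by (simp add: card_Diff_singleton)
  then obtain y where y: "bij_betw y {1..2 * n} (Basis - {z})"
    using ex_bij_betw_nat_finite_1[of "Basis - {z}"] by auto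
  have yB: "y a \<in> Basis" "y a \<noteq> z" if "a \<in> {1..2 * n}" for a
    using y that by (auto simp: bij_betw_def)
  have yy: "y a \<bullet> y b = of_bool (a = b)" if "a \<in> {1..2 * n}" "b \<in> {1..2 * n}" for a b
    using inj_on_eq_iff[OF bij_betw_imp_inj_on[OF y] that] yB(1)[OF that(1)] yB(1)[OF that(2)]
    by (simp add: inner_Basis)
  have zy: "z \<bullet> y a = 0" if "a \<in> {1..2 * n}" for a
    using z yB[OF that] by (metis inner_Basis)
  define c where "c u v = (\<Sum>k\<in>{1..n}. (u \<bullet> y (2 * k - 1)) * (v \<bullet> y (2 * k)) -
      (u \<bullet> y (2 * k)) * (v \<bullet> y (2 * k - 1)))" for u v
  define br where "br u v = c u v *\<^sub>R z" for u v
  have c_add: "c (u + u') v = c u v + c u' v" "c u (v + v') = c u v + c u v'" for u u' v v'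
    by (simp_all add: c_def inner_add_left algebra_simps flip: sum.distrib)
  have c_scale: "c (r *\<^sub>R u) v = r * c u v" "c u (r *\<^sub>R v) = r * c u v" for r u v
    by (simp_all add: c_def sum_distrib_left algebra_simps)
  have c_z: "c u z = 0" for u
  proof -
    have "z \<bullet> y (2 * k) = 0" "z \<bullet> y (2 * k - 1) = 0" if "k \<in> {1..n}" for k
      using that by (intro zy; auto)+
    then show ?thesis unfolding c_def by (intro sum.neutral) simp
  qed
  have "lie_bracket br"
    by (simp add: lie_bracket_def bilinear_def linear_iff br_def c_add c_scale c_z
        scaleR_left_distrib) (simp add: c_def)
  moreover have "br (y (2 * k - 1)) (y (2 * k)) = z" if k: "k \<in> {1..n}" for k
  proof -
    have "c (y (2 * k - 1)) (y (2 * k)) = (\<Sum>l\<in>{1..n}. if l = k then 1 else 0)"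
      unfolding c_def
    proof (rule sum.cong)
      fix l assume l: "l \<in> {1..n}"
      have "2 * k - 1 \<noteq> 2 * l" "2 * k - 1 = 2 * l - 1 \<longleftrightarrow> l = k" using k l by (auto, presburger)
      then show "(y (2 * k - 1) \<bullet> y (2 * l - 1)) * (y (2 * k) \<bullet> y (2 * l)) -
          (y (2 * k - 1) \<bullet> y (2 * l)) * (y (2 * k) \<bullet> y (2 * l - 1)) = (if l = k then 1 else 0)"
        using k l by (subst (1 2 3 4) yy) auto
    qed simp
    then show ?thesis using k by (simp add: br_def)
  qed
  moreover have "br (y a) (y b) = 0"
    if ab: "a \<in> {1..2 * n}" "b \<in> {1..2 * n}" "a < b" "\<not> (\<exists>k\<in>{1..n}. a = 2 * k - 1 \<and> b = 2 * k)"
    for a b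
  proof -
    have "c (y a) (y b) = 0"
      unfolding c_def
    proof (rule sum.neutral, rule ballI)
      fix l assume l: "l \<in> {1..n}"
      have "\<not> (a = 2 * l - 1 \<and> b = 2 * l)" "\<not> (a = 2 * l \<and> b = 2 * l - 1)"
        using ab l by auto
      then show "(y a \<bullet> y (2 * l - 1)) * (y b \<bullet> y (2 * l)) -
          (y a \<bullet> y (2 * l)) * (y b \<bullet> y (2 * l - 1)) = 0"
        using ab(1,2) l by (subst (1 2 3 4) yy) auto
    qed
    then show ?thesis by (simp add: br_def)
  qed
  moreover have "br u z = 0" for u by (simp add: br_def c_z)
  ultimately have "heisenberg n br y z"
    using y z unfolding heisenberg_def by blast
  then show ?thesis by blast
qed

end

theory Submission
  imports Defs "HOL-Computational_Algebra.Polynomial"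
begin

text \<open>
  Put \<open>\<Omega> = \<Sum>\<^sub>k y\<^sub>2\<^sub>k\<^sub>-\<^sub>1\<^sup>* \<and> y\<^sub>2\<^sub>k\<^sup>* = d z\<^sup>*\<close> and let \<open>\<Lambda>\<close> be the adjoint of the product with \<open>\<Omega>\<close>.
  Since \<open>d\<close> replaces \<open>z\<^sup>*\<close> by \<open>\<Omega>\<close> and kills every \<open>y\<^sub>i\<^sup>*\<close>, the basic Laplacian is
  \<open>\<omega> \<mapsto> \<Omega> \<and> \<Lambda> \<omega>\<close> (\<open>laplacian_eq\<close>). As in the Lefschetz theory of a symplectic vector space of
  dimension \<open>2 n\<close>, the two operators satisfy \<open>\<Lambda> (\<Omega> \<and> \<omega>) = \<Omega> \<and> \<Lambda> \<omega> + (n - d) \<omega>\<close> on basic forms of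
  degree \<open>d\<close> (\<open>Lambda_wedge_Omega\<close>).

  This relation between adjoint operators yields the multiplicities, without a decomposition into irreducible
  \<open>sl\<^sub>2\<close>-modules and without the spectral theorem. If \<open>e d \<mu>\<close> is the multiplicity of the
  eigenvalue \<open>\<mu>\<close> in degree \<open>d\<close>, then \<open>\<Omega>\<close> and \<open>\<Lambda>\<close> identify eigenspaces for nonzero eigenvalues in
  degrees \<open>d\<close> and \<open>d + 2\<close>, and for the eigenvalue \<open>0\<close> an index computation applies. Hence
  \<open>e (d + 2) \<mu> = e d (\<mu> - (n - d))\<close>, increased by \<open>(2n choose d + 2) - (2n choose d)\<close> if
  \<open>\<mu> = 0\<close> (\<open>dim_eigenspace_shift\<close>). By induction, \<open>e d \<mu>\<close> is the sum of the numbers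
  \<open>w p = (2n choose p) - (2n choose p - 2)\<close> over all \<open>p = d - 2 r\<close> with \<open>r (n - d + r + 1) = \<mu>\<close>.

  For \<open>d > n\<close> some of the \<open>w p\<close> may be negative, but \<open>w (2 n + 2 - p) = - w p\<close> makes all terms with
  \<open>r < d - n\<close> cancel (\<open>sum_primitive_cancel\<close>). In the others \<open>p \<le> n\<close>, and the expansion of
  \<open>(1 + X)\<^sup>2\<^sup>n = (2 X + (1 + X\<^sup>2))\<^sup>n\<close> writes \<open>w p\<close> as the sum of the \<open>N\<^sub>n\<^sub>,\<^sub>k\<^sub>,\<^sub>j\<close> with
  \<open>k + 2 j = p\<close> (\<open>primitive_dim_eq_sum\<close>). With \<open>m = r + j\<close> the degree is \<open>2 m + k\<close> and the
  eigenvalue is \<open>(m - j) (n - k - m - j + 1)\<close>.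
\<close>

section \<open>Eigenspaces of products of adjoint operators\<close>

lemma dim_le_of_linear_inj:
  fixes f :: "'a::euclidean_space \<Rightarrow> 'b::euclidean_space"
  assumes "linear f" "subspace V" "f ` V \<subseteq> W" "\<And>v. v \<in> V \<Longrightarrow> f v = 0 \<Longrightarrow> v = 0"
  shows "dim V \<le> dim W"
proof -
  have "inj_on f V"
    using assms(4) linear_inj_on_iff_eq_0[OF assms(1,2)] by blast
  then have "inj_on f (span V)" using assms(2) by (metis span_eq_iff)
  then have "dim V = dim (f ` V)" using assms(1) by (simp add: dim_image_eq)
  also have "\<dots> \<le> dim W" by (rule dim_subset[OF assms(3)])
  finally show ?thesis .
qed

lemma subspace_eigenspace:
  assumes "linear f" "subspace V"
  shows "subspace {v \<in> V. f v = c *\<^sub>R v}"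
  using assms
  by (auto simp: subspace_def linear_0 linear_add linear_cmul scaleR_add_right)

lemma subspace_kernel_on:
  assumes "linear f" "subspace V"
  shows "subspace {v \<in> V. f v = 0}"
  using assms by (auto simp: subspace_def linear_0 linear_add linear_cmul)

text \<open>
  \<open>L\<close> is injective on the orthogonal complement \<open>P\<close> of its kernel, and the kernel of the
  adjoint \<open>M\<close> is orthogonal to \<open>L ` P\<close>. Interchanging \<open>L\<close> and \<open>M\<close> gives the reverse
  inequality, and hence the index of \<open>L : V \<rightarrow> W\<close>.
\<close>

lemma dim_kernel_adjoint_le:
  fixes L :: "'a::euclidean_space \<Rightarrow> 'b::euclidean_space"
  assumes "linear L" "linear M" "subspace V" "subspace W" "L ` V \<subseteq> W"
    and adj: "\<And>v w. L v \<bullet> w = v \<bullet> M w"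
  shows "dim V + dim {w \<in> W. M w = 0} \<le> dim W + dim {v \<in> V. L v = 0}"
proof -
  define K where "K = {v \<in> V. L v = 0}"
  define P where "P = {v \<in> V. \<forall>x\<in>K. orthogonal x v}"
  have K: "subspace K" unfolding K_def by (rule subspace_kernel_on[OF assms(1,3)])
  have P: "subspace P"
    using assms(3) by (auto simp: P_def subspace_def orthogonal_def inner_add)
  have dimV: "dim P + dim K = dim V"
    unfolding P_def using K assms(3) by (intro dim_subspace_orthogonal_to_vectors) (auto simp: K_def)
  have LP: "subspace (L ` P)" by (rule linear_subspace_image[OF assms(1) P])
  have "dim P \<le> dim (L ` P)"
  proof (rule dim_le_of_linear_inj[OF assms(1) P order_refl])
    fix v assume "v \<in> P" "L v = 0"
    then have "v \<in> K" "\<forall>x\<in>K. orthogonal x v" by (auto simp: P_def K_def)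
    then show "v = 0" by (auto simp: orthogonal_def)
  qed
  moreover have "dim {w \<in> W. \<forall>x\<in>L ` P. orthogonal x w} + dim (L ` P) = dim W"
    using LP assms(4,5) by (intro dim_subspace_orthogonal_to_vectors) (auto simp: P_def)
  moreover have "dim {w \<in> W. M w = 0} \<le> dim {w \<in> W. \<forall>x\<in>L ` P. orthogonal x w}"
    by (rule dim_subset) (auto simp: orthogonal_def adj)
  ultimately show ?thesis using dimV unfolding K_def by linarith
qed

lemma dim_kernel_adjoint_eq:
  fixes L :: "'a::euclidean_space \<Rightarrow> 'b::euclidean_space"
  assumes "linear L" "linear M" "subspace V" "subspace W" "L ` V \<subseteq> W" "M ` W \<subseteq> V"
    and adj: "\<And>v w. L v \<bullet> w = v \<bullet> M w"
  shows "dim V + dim {w \<in> W. M w = 0} = dim W + dim {v \<in> V. L v = 0}"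
proof -
  have "M w \<bullet> v = w \<bullet> L v" for v w
    using adj[of v w] by (simp add: inner_commute)
  with dim_kernel_adjoint_le[OF assms(2,1,4,3,6)] dim_kernel_adjoint_le[OF assms(1-5) adj] show ?thesis by fastforce
qed

text \<open>
  This is how multiplicities climb a ladder. For \<open>\<mu> \<noteq> 0\<close> the maps \<open>M\<close> and \<open>L\<close> embed the
  \<open>\<mu>\<close>-eigenspaces of \<open>L M\<close> and \<open>M L\<close> into each other, and \<open>M L = A + c\<close> turns the latter into
  an eigenspace of \<open>A\<close>. For \<open>\<mu> = 0\<close> the eigenspaces are the kernels of \<open>M\<close> and \<open>L\<close>, because
  \<open>M\<close> is adjoint to \<open>L\<close>, and their dimensions differ by the index.
\<close>

lemma dim_eigenspace_shift:
  fixes L :: "'a::euclidean_space \<Rightarrow> 'b::euclidean_space"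
  assumes L: "linear L" and M: "linear M" and V: "subspace V" and W: "subspace W"
    and LV: "L ` V \<subseteq> W" and MW: "M ` W \<subseteq> V"
    and adj: "\<And>v w. L v \<bullet> w = v \<bullet> M w"
    and comm: "\<And>v. v \<in> V \<Longrightarrow> M (L v) = A v + c *\<^sub>R v"
  shows "real (dim {w \<in> W. L (M w) = \<mu> *\<^sub>R w}) =
    real (dim {v \<in> V. A v = (\<mu> - c) *\<^sub>R v}) + (if \<mu> = 0 then real (dim W) - real (dim V) else 0)"
proof -
  have E: "{v \<in> V. A v = (\<mu> - c) *\<^sub>R v} = {v \<in> V. M (L v) = \<mu> *\<^sub>R v}"
    using comm by (auto simp: algebra_simps)
  have linLM: "linear (\<lambda>w. L (M w))" and linML: "linear (\<lambda>v. M (L v))"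
    using linear_compose[OF M L] linear_compose[OF L M] by (simp_all add: o_def)
  note s = linear_cmul[OF L] linear_cmul[OF M]
  show ?thesis
  proof (cases "\<mu> = 0")
    case True
    have "w \<in> W \<and> L (M w) = 0 \<longleftrightarrow> w \<in> W \<and> M w = 0" for w
      using adj[of "M w" w] linear_0[OF L] by (metis inner_eq_zero_iff inner_zero_left)
    moreover have "v \<in> V \<and> M (L v) = 0 \<longleftrightarrow> v \<in> V \<and> L v = 0" for v
      using adj[of v "L v"] linear_0[OF M] by (metis inner_eq_zero_iff inner_zero_right)
    ultimately show ?thesis
      using dim_kernel_adjoint_eq[OF L M V W LV MW adj] True unfolding E by simp
  next
    case False
    have "dim {w \<in> W. L (M w) = \<mu> *\<^sub>R w} \<le> dim {v \<in> V. M (L v) = \<mu> *\<^sub>R v}"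
      using False MW by (intro dim_le_of_linear_inj[OF M] subspace_eigenspace[OF linLM W])
        (auto simp: s linear_0[OF L])
    moreover have "dim {v \<in> V. M (L v) = \<mu> *\<^sub>R v} \<le> dim {w \<in> W. L (M w) = \<mu> *\<^sub>R w}"
      using False LV by (intro dim_le_of_linear_inj[OF L] subspace_eigenspace[OF linML V])
        (auto simp: s linear_0[OF M])
    ultimately show ?thesis using False E by simp
  qed
qed

section \<open>Virtual multiplicities and their cancellation\<close>

text \<open>
  The dimension of the space of primitive forms of degree \<open>p\<close> (those killed by the adjoint of
  \<open>\<Omega>\<close>) when \<open>p \<le> n\<close>. For \<open>p > n + 1\<close> the value is negative or zero; it is then a virtual
  multiplicity.
\<close>

definition primitive_dim :: "nat \<Rightarrow> nat \<Rightarrow> real" where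
  "primitive_dim n p = real ((2 * n) choose p) - (if p < 2 then 0 else real ((2 * n) choose (p - 2)))"

text \<open>
  Compare coefficients in \<open>(X + 1)\<^sup>2\<^sup>n = (2 X + (X\<^sup>2 + 1))\<^sup>n\<close>. Combinatorially, a \<open>p\<close>-subset
  of \<open>n\<close> pairs meets \<open>k\<close> pairs in one point and contains \<open>j\<close> pairs entirely.
\<close>

lemma choose_double_eq_sum:
  "(2 * n) choose p = (\<Sum>(k, j) | k + 2 * j = p. 2 ^ k * (n choose k) * ((n - k) choose j))"
proof -
  define X :: "nat poly" where "X = monom 1 1"
  have m: "of_nat c * monom (b::nat) i = monom (c * b) i" for c b i
    by (metis mult.commute of_nat_poly mult_monom add_0 monom_0 of_nat_id mult.comm_neutral)
  have "coeff ((X + 1) ^ (2 * n)) p = (\<Sum>k\<le>2 * n. if k = p then (2 * n) choose k else 0)"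
    unfolding binomial_ring by (simp add: X_def monom_power coeff_sum m)
  also have "\<dots> = (2 * n) choose p" by (simp add: binomial_eq_0)
  finally have lhs: "coeff ((X + 1) ^ (2 * n)) p = (2 * n) choose p" .
  have fin: "finite {(k, j). k + 2 * j = p}"
    by (rule finite_subset[of _ "{..p} \<times> {..p}"]) auto
  have "(X + 1) ^ (2 * n) = (2 * X + (X ^ 2 + 1)) ^ n"
  proof -
    have "(X + 1) ^ 2 = 2 * X + (X ^ 2 + 1)" by (simp add: power2_eq_square distrib_left distrib_right mult_2 add_ac)
    then show ?thesis by (simp add: power_mult)
  qed
  also have "\<dots> = (\<Sum>k\<le>n. \<Sum>j\<le>n - k. monom (2 ^ k * (n choose k) * ((n - k) choose j)) (k + 2 * j))"
    unfolding binomial_ring[of "2 * X"] binomial_ring[of "X ^ 2"] sum_distrib_left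
  proof (intro sum.cong refl)
    fix k j
    have "of_nat (n choose k) * (2 * X) ^ k * (of_nat ((n - k) choose j) * (X ^ 2) ^ j * 1 ^ (n - k - j)) =
       of_nat (2 ^ k * (n choose k) * ((n - k) choose j)) * (X ^ (k + 2 * j))"
      by (simp add: power_mult_distrib power_add power_mult[symmetric] mult_ac)
    also have "\<dots> = monom (2 ^ k * (n choose k) * ((n - k) choose j)) (k + 2 * j)"
      by (simp only: X_def monom_power m) simp
    finally show "of_nat (n choose k) * (2 * X) ^ k * (of_nat ((n - k) choose j) * (X ^ 2) ^ j * 1 ^ (n - k - j)) = \<dots>" .
  qed
  also have "\<dots> = (\<Sum>(k, j)\<in>(SIGMA k:{..n}. {..n - k}). monom (2 ^ k * (n choose k) * ((n - k) choose j)) (k + 2 * j))"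
    by (simp add: sum.Sigma)
  finally have "coeff ((X + 1) ^ (2 * n)) p =
     (\<Sum>(k, j)\<in>(SIGMA k:{..n}. {..n - k}). if k + 2 * j = p then 2 ^ k * (n choose k) * ((n - k) choose j) else 0)"
    by (simp add: coeff_sum case_prod_unfold)
  also have "\<dots> = (\<Sum>(k, j)\<in>{(k, j). k + 2 * j = p}. 2 ^ k * (n choose k) * ((n - k) choose j))"
    using fin by (intro sum.mono_neutral_cong) (auto simp: binomial_eq_0_iff)
  finally show ?thesis by (simp add: lhs)
qed

text \<open>
  The quotient in the definition is the ratio that makes a binomial coefficient into a difference
  of two consecutive ones.
\<close>

lemma heisenberg_multiplicity_eq:
  assumes "k + j \<le> n"
  shows "heisenberg_multiplicity n k j =
    2 ^ k * (n choose k) * (real ((n - k) choose j) - (if j = 0 then 0 else real ((n - k) choose (j - 1))))"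
proof (cases j)
  case (Suc i)
  have 1: "real (n choose k) * real ((n - k) choose j) = fact n / (fact k * fact j * fact (n - k - j))"
    using assms by (simp add: binomial_fact)
  have 2: "real ((n - k) choose j) * real j = real ((n - k) choose i) * (real n - real k - real j + 1)"
  proof -
    have "real ((n - k) choose j) * real j = real ((n - k) choose i) * real (n - k - i)"
      using binomial_absorb_comp[of "n - k" i] binomial_absorption[of i "n - k"] Suc
      by (metis binomial_absorption binomial_absorb_comp mult.commute of_nat_mult)
    then show ?thesis using assms Suc by (simp add: of_nat_diff algebra_simps)
  qed
  have pos: "real n - real k - real j + 1 > 0" using assms by linarith
  have "real ((n - k) choose j) * ((real n - real k - 2 * real j + 1) / (real n - real k - real j + 1)) =
     real ((n - k) choose j) - real ((n - k) choose i)"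
    using 2 pos by (simp add: field_simps)
  moreover have "heisenberg_multiplicity n k j = 2 ^ k * (real (n choose k) * real ((n - k) choose j)) *
      ((real n - real k - 2 * real j + 1) / (real n - real k - real j + 1))"
    unfolding heisenberg_multiplicity_def 1 using Suc by simp
  ultimately have "heisenberg_multiplicity n k j =
      2 ^ k * real (n choose k) * (real ((n - k) choose j) - real ((n - k) choose i))"
    by (simp only: mult.assoc)
  then show ?thesis using Suc by simp
qed (simp add: heisenberg_multiplicity_def)

text \<open>
  The binomial coefficients subtracted in the multiplicities are those in the expansion of
  \<open>(2n choose p - 2)\<close>, with \<open>j\<close> shifted by one.
\<close>

lemma primitive_dim_eq_sum:
  assumes "p \<le> n"
  shows "primitive_dim n p = (\<Sum>(k, j) | k + 2 * j = p. heisenberg_multiplicity n k j)"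
proof -
  have fin: "finite {(k, j). k + 2 * j = p}"
    by (rule finite_subset[of _ "{..p} \<times> {..p}"]) auto
  let ?g = "\<lambda>(k, j). 2 ^ k * (n choose k) * (if j = 0 then 0 else real ((n - k) choose (j - 1)))"
  have "(\<Sum>(k, j) | k + 2 * j = p. heisenberg_multiplicity n k j) =
     (\<Sum>(k, j) | k + 2 * j = p. 2 ^ k * (n choose k) * real ((n - k) choose j)) - sum ?g {(k, j). k + 2 * j = p}"
    unfolding sum_subtractf[symmetric]
    using assms by (intro sum.cong) (auto simp: heisenberg_multiplicity_eq algebra_simps)
  also have "(\<Sum>(k, j) | k + 2 * j = p. 2 ^ k * (n choose k) * real ((n - k) choose j)) = real ((2 * n) choose p)"
    unfolding choose_double_eq_sum of_nat_sum by (intro sum.cong) auto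
  also have "sum ?g {(k, j). k + 2 * j = p} = (if p < 2 then 0 else real ((2 * n) choose (p - 2)))"
  proof (cases "p < 2")
    case True
    then show ?thesis by (auto intro!: sum.neutral)
  next
    case False
    have "sum ?g {(k, j). k + 2 * j = p} = sum ?g ((\<lambda>(k, j). (k, Suc j)) ` {(k, j). k + 2 * j = p - 2})"
    proof (intro sum.mono_neutral_right fin ballI)
      fix x assume "x \<in> {(k, j). k + 2 * j = p} - (\<lambda>(k, j). (k, Suc j)) ` {(k, j). k + 2 * j = p - 2}"
      moreover obtain k j where "x = (k, j)" by fastforce
      ultimately show "?g x = 0" using False by (cases j) (auto simp: image_iff)
    qed (use False in auto)
    also have "\<dots> = real ((2 * n) choose (p - 2))"
      unfolding choose_double_eq_sum of_nat_sum
      by (subst sum.reindex) (auto simp: inj_on_def intro!: sum.cong)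
    finally show ?thesis using False by simp
  qed
  finally show ?thesis by (simp add: primitive_dim_def)
qed

text \<open>
  The reflection \<open>p \<mapsto> 2 n + 2 - p\<close> of weights interchanges the two binomial coefficients.
\<close>

lemma primitive_dim_antisym:
  assumes "p + q = 2 * n + 2"
  shows "primitive_dim n p = - primitive_dim n q"
proof -
  have *: "(if p < 2 then 0 else real ((2 * n) choose (p - 2))) = real ((2 * n) choose q)"
    if "p + q = 2 * n + 2" for p q
  proof (cases "p < 2")
    case False
    then have "q \<le> 2 * n" "2 * n - q = p - 2" using that by auto
    then show ?thesis using False binomial_symmetric[of q "2 * n"] by simp
  qed (use that in \<open>simp add: binomial_eq_0\<close>)
  show ?thesis unfolding primitive_dim_def using *[OF assms] *[of q p] assms by simp
qed

text \<open>
  The eigenvalue of the Laplacian on \<open>\<Omega>\<^sup>r \<and> \<alpha>\<close> of total degree \<open>d\<close>, for \<open>\<alpha>\<close> primitive of degree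
  \<open>d - 2 r\<close>.
\<close>

definition string_eigenvalue :: "nat \<Rightarrow> nat \<Rightarrow> nat \<Rightarrow> real" where
  "string_eigenvalue n d r = real r * (real n - real d + real r + 1)"

text \<open>
  Above the middle degree, \<open>r \<mapsto> d - n - 1 - r\<close> fixes the eigenvalue and reflects the primitive
  degree \<open>d - 2 r\<close>, so these virtual multiplicities cancel in pairs.
\<close>

lemma sum_primitive_cancel:
  fixes f :: "real \<Rightarrow> complex"
  assumes "n < d" "d \<le> 2 * n + 1"
  shows "(\<Sum>r<d - n. of_real (primitive_dim n (d - 2 * r)) * f (string_eigenvalue n d r)) = 0"
proof -
  let ?g = "\<lambda>r. of_real (primitive_dim n (d - 2 * r)) * f (string_eigenvalue n d r)"
  have "?g (d - n - Suc r) = - ?g r" if "r < d - n" for r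
  proof -
    have "primitive_dim n (d - 2 * (d - n - Suc r)) = - primitive_dim n (d - 2 * r)"
      using that assms by (intro primitive_dim_antisym) linarith
    moreover have "string_eigenvalue n d (d - n - Suc r) = string_eigenvalue n d r"
    proof -
      have "real (d - n - Suc r) = real d - real n - real r - 1" using that assms by linarith
      then show ?thesis by (simp add: string_eigenvalue_def algebra_simps)
    qed
    ultimately show ?thesis by simp
  qed
  then have "sum ?g {..<d - n} = - sum ?g {..<d - n}"
    by (subst sum.nat_diff_reindex[symmetric]) (simp add: sum_negf)
  then show ?thesis by simp
qed

lemma sum_triple_Sigma:
  assumes "finite A" "\<And>x. finite (B x)" "\<And>x y. finite (C x y)"
  shows "(\<Sum>x\<in>A. \<Sum>y\<in>B x. \<Sum>z\<in>C x y. h x y z) =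
    (\<Sum>(x, y, z)\<in>(SIGMA x:A. SIGMA y:B x. C x y). h x y z)"
  using assms by (simp add: sum.Sigma)

text \<open>
  After the cancellation only \<open>r \<ge> d - n\<close> remain, for which the primitive degree \<open>p = d - 2 r\<close> is
  at most \<open>n\<close> and the eigenvalue is a natural number. Splitting \<open>p = k + 2 j\<close> and putting
  \<open>m = r + j\<close> makes \<open>r \<ge> 0\<close> and \<open>r \<ge> d - n\<close> into \<open>j \<le> m\<close> and \<open>j \<le> n - k - m\<close>.
\<close>

lemma sum_over_strings:
  fixes F :: "real \<Rightarrow> complex" and s t :: complex
  assumes F: "\<And>k :: nat. F (real k) = s ^ k"
  shows "(\<Sum>d\<le>2 * n + 1. (\<Sum>r\<le>d div 2. of_real (primitive_dim n (d - 2 * r)) *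
      F (string_eigenvalue n d r)) * t ^ d) =
    (\<Sum>k=0..n. \<Sum>m=0..n - k. \<Sum>j=0..min m (n - k - m).
       of_real (heisenberg_multiplicity n k j) *
       s ^ ((m - j) * (n - k - m - j + 1)) * t ^ (2 * m + k))"
proof -
  let ?N = "\<lambda>k j. of_real (heisenberg_multiplicity n k j) :: complex"
  have "(\<Sum>r\<le>d div 2. of_real (primitive_dim n (d - 2 * r)) * F (string_eigenvalue n d r)) * t ^ d =
      (\<Sum>r\<in>{d - n..d div 2}. \<Sum>(k, j) | k + 2 * j = d - 2 * r.
         ?N k j * s ^ (r * (n + r + 1 - d)) * t ^ d)" if d: "d \<le> 2 * n + 1" for d
  proof -
    let ?g = "\<lambda>r. of_real (primitive_dim n (d - 2 * r)) * F (string_eigenvalue n d r)"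
    have "{..d div 2} = {..<d - n} \<union> {d - n..d div 2}" using d by auto
    moreover have "sum ?g ({..<d - n} \<union> {d - n..d div 2}) = sum ?g {..<d - n} + sum ?g {d - n..d div 2}"
      by (intro sum.union_disjoint) auto
    moreover have "sum ?g {..<d - n} = 0"
      using sum_primitive_cancel[of n d F] d by (cases "n < d") auto
    ultimately have "sum ?g {..d div 2} = sum ?g {d - n..d div 2}" by simp
    moreover have "?g r * t ^ d = (\<Sum>(k, j) | k + 2 * j = d - 2 * r.
         ?N k j * s ^ (r * (n + r + 1 - d)) * t ^ d)" if r: "r \<in> {d - n..d div 2}" for r
    proof -
      have le: "d - 2 * r \<le> n" "d \<le> n + r + 1" using r d by auto
      have "string_eigenvalue n d r = real (r * (n + r + 1 - d))"
        using le(2) by (simp add: string_eigenvalue_def) 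
      then show ?thesis
        by (simp only: F primitive_dim_eq_sum[OF le(1)] sum_distrib_right of_real_sum case_prod_unfold)
    qed
    ultimately show ?thesis by (simp add: sum_distrib_right)
  qed
  then have "(\<Sum>d\<le>2 * n + 1. (\<Sum>r\<le>d div 2. of_real (primitive_dim n (d - 2 * r)) *
      F (string_eigenvalue n d r)) * t ^ d) =
    (\<Sum>d\<le>2 * n + 1. \<Sum>r\<in>{d - n..d div 2}. \<Sum>(k, j)\<in>{(k, j). k + 2 * j = d - 2 * r}.
         ?N k j * s ^ (r * (n + r + 1 - d)) * t ^ d)"
    by simp
  also have "\<dots> = (\<Sum>(d, r, k, j)\<in>(SIGMA d:{..2 * n + 1}. SIGMA r:{d - n..d div 2}.
      {(k, j). k + 2 * j = d - 2 * r}). ?N k j * s ^ (r * (n + r + 1 - d)) * t ^ d)"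
  proof -
    have "finite {(k, j). k + 2 * j = p}" for p :: nat
      by (rule finite_subset[of _ "{..p} \<times> {..p}"]) auto
    then show ?thesis by (simp add: sum.Sigma del: sum.atMost_Suc)
  qed
  also have "\<dots> = (\<Sum>(k, m, j)\<in>(SIGMA k:{0..n}. SIGMA m:{0..n - k}. {0..min m (n - k - m)}).
      ?N k j * s ^ ((m - j) * (n - k - m - j + 1)) * t ^ (2 * m + k))"
  proof (rule sum.reindex_bij_witness[of _ "\<lambda>(k, m, j). (2 * m + k, m - j, k, j)"
        "\<lambda>(d, r, k, j). (k, r + j, j)"], goal_cases)
    case (1 x) then show ?case by auto
  next
    case (2 x) then show ?case by auto
  next
    case (3 x) then show ?case by auto
  next
    case (4 x) then show ?case by auto
  next
    case (5 x)
    then obtain d r k j where x: "x = (d, r, k, j)" and *: "d \<le> 2 * n + 1" "d - n \<le> r"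
      "r \<le> d div 2" "k + 2 * j = d - 2 * r" by auto
    have "2 * r \<le> d" using *(3) by linarith
    then have d: "2 * (r + j) + k = d" using *(4) by simp
    moreover have "k + r + 2 * j \<le> n" using d *(2) by simp
    ultimately have "n - k - (r + j) - j + 1 = n + r + 1 - d" by simp
    with d show ?case by (simp only: x prod.case diff_add_inverse2)
  qed
  also have "\<dots> = (\<Sum>k=0..n. \<Sum>m=0..n - k. \<Sum>j=0..min m (n - k - m).
       ?N k j * s ^ ((m - j) * (n - k - m - j + 1)) * t ^ (2 * m + k))"
    by (rule sum_triple_Sigma[symmetric]) auto
  finally show ?thesis .
qed

section \<open>Contractions and wedge products\<close>

lemma inner_contract: "contract i \<omega> \<bullet> \<eta> = \<omega> \<bullet> wedge (mon {i}) \<eta>"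
proof (rule linear_eq_mon[of "\<lambda>\<omega>. contract i \<omega> \<bullet> \<eta>"])
  fix S
  show "contract i (mon S) \<bullet> \<eta> = mon S \<bullet> wedge (mon {i}) \<eta>"
  proof (rule linear_eq_mon[of "\<lambda>\<eta>. contract i (mon S) \<bullet> \<eta>"])
    fix T
    show "contract i (mon S) \<bullet> mon T = mon S \<bullet> wedge (mon {i}) (mon T)"
      by (auto simp: contract_mon wedge_mon inner_axis_axis)
  qed (auto simp: linear_iff inner_add wedge_add_right wedge_scale_right)
qed (auto simp: linear_iff inner_add linear_add[OF linear_contract] contract_scale)

lemma wedge_support:
  assumes "wedge \<omega> \<eta> $ S \<noteq> 0"
  obtains T where "T \<subseteq> S" "\<omega> $ T \<noteq> 0" "\<eta> $ (S - T) \<noteq> 0"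
proof -
  have "\<exists>T\<in>Pow S. shuffle_sign T (S - T) * \<omega> $ T * \<eta> $ (S - T) \<noteq> 0"
    using assms by (auto simp: wedge_def intro: sum.neutral)
  then show ?thesis using that by auto
qed

text \<open>
  The number operator: each \<open>e\<^sub>i\<^sup>* \<and> \<partial>/\<partial>e\<^sub>i\<^sup>*\<close> projects onto the monomials that contain \<open>e\<^sub>i\<^sup>*\<close>.
\<close>

lemma sum_wedge_contract:
  assumes "homogeneous d \<omega>"
  shows "(\<Sum>i\<in>UNIV. wedge (mon {i}) (contract i \<omega>)) = real d *\<^sub>R \<omega>"
proof (rule linear_eq_homogeneous[OF _ _ assms, of "\<lambda>\<omega>. \<Sum>i\<in>UNIV. wedge (mon {i}) (contract i \<omega>)"])
  fix S :: "'a set"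
  assume S: "card S = d"
  have "wedge (mon {i}) (contract i (mon S)) = (if i \<in> S then mon S else 0)" for i
    by (auto simp: contract_mon wedge_mon wedge_scale_right wedge_zero_right insert_absorb)
  then show "(\<Sum>i\<in>UNIV. wedge (mon {i}) (contract i (mon S))) = real d *\<^sub>R mon S"
    by (simp add: sum.If_cases S sum_constant_scaleR del: sum_constant)
qed (intro real_vector.linear_compose_sum ballI linear_wedge_right linear_contract
  real_vector.linear_compose_scale_right real_vector.linear_ident)+

lemma homogeneous_mon_single [simp]: "homogeneous (Suc 0) (mon {i})"
  by (simp add: homogeneous_def axis_def)

lemma contract_mon_single: "contract i (mon {p}) = (if i = p then mon {} else 0)"
  by (simp add: contract_mon)

lemma contract_wedge_single:
  "contract i (wedge (mon {p}) \<omega>) = (if i = p then \<omega> else 0) - wedge (mon {p}) (contract i \<omega>)"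
  using contract_wedge[of 1 "mon {p}" i \<omega>]
  by (simp add: contract_mon_single wedge_zero_left)

lemma axis_nth_if: "axis i x $ j = (if j = i then x else 0)"
  by (simp add: axis_def)

lemma mon_nth: "mon S $ T = (if T = S then 1 else 0)"
  by (simp add: axis_def)

lemma bilinear_symplectic_form:
  fixes a b :: "nat \<Rightarrow> 'i::finite"
  shows "bilinear (\<lambda>x y :: 'i vect. (\<Sum>k\<in>K. x $ a k * y $ b k - x $ b k * y $ a k) *\<^sub>R z)"
proof -
  define B where "B x y = (\<Sum>k\<in>K. x $ a k * y $ b k - x $ b k * y $ a k)" for x y :: "'i vect"
  have "B (x + x') y = B x y + B x' y" "B x (y + y') = B x y + B x y'" for x x' y y'
    by (simp_all add: B_def algebra_simps flip: sum.distrib)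
  moreover have "B (r *\<^sub>R x) y = r * B x y" "B x (r *\<^sub>R y) = r * B x y" for r x y
    by (simp_all add: B_def algebra_simps sum_distrib_left)
  ultimately have "bilinear (\<lambda>x y. B x y *\<^sub>R z)"
    by (simp add: bilinear_def linear_iff scaleR_left_distrib)
  then show ?thesis by (simp add: B_def)
qed

section \<open>The symplectic form and the Laplacian\<close>

text \<open>
  Coordinates in which the standard basis of the Heisenberg algebra is visible: \<open>a k\<close>, \<open>b k\<close> and
  \<open>c\<close> are the indices of the basis vectors \<open>y\<^sub>2\<^sub>k\<^sub>-\<^sub>1\<close>, \<open>y\<^sub>2\<^sub>k\<close> and \<open>z\<close>. The position of these indices
  in the order of \<open>'i\<close> is arbitrary, so the signs are left to \<open>wedge\<close> and \<open>contract\<close> and are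
  compared only once, for the coefficients of \<open>\<Omega>\<close>.
\<close>

locale heisenberg_frame =
  fixes n :: nat and br :: "'i::{finite,linorder} bracket" and a b :: "nat \<Rightarrow> 'i" and c :: 'i
  assumes n: "n \<ge> 1"
    and a_eq: "\<And>k l. k \<in> {1..n} \<Longrightarrow> l \<in> {1..n} \<Longrightarrow> a k = a l \<longleftrightarrow> k = l"
    and b_eq: "\<And>k l. k \<in> {1..n} \<Longrightarrow> l \<in> {1..n} \<Longrightarrow> b k = b l \<longleftrightarrow> k = l"
    and a_neq_b: "\<And>k l. k \<in> {1..n} \<Longrightarrow> l \<in> {1..n} \<Longrightarrow> a k \<noteq> b l"
    and ab_range: "a ` {1..n} \<union> b ` {1..n} = - {c}"
    and br_eq: "\<And>x y. br x y = (\<Sum>k=1..n. x $ a k * y $ b k - x $ b k * y $ a k) *\<^sub>R axis c 1"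
begin

definition Omega :: "'i cochain" where
  "Omega = (\<Sum>k=1..n. wedge (mon {a k}) (mon {b k}))"

text \<open>
  The adjoint of the wedge product with \<open>\<Omega>\<close>, see \<open>inner_wedge_Omega\<close>.
\<close>

definition Lambda :: "'i cochain \<Rightarrow> 'i cochain" where
  "Lambda \<omega> = (\<Sum>k=1..n. contract (b k) (contract (a k) \<omega>))"

text \<open>
  The basic cochains of degree \<open>d\<close>: polynomials in the \<open>y\<^sub>i\<^sup>*\<close> without \<open>z\<^sup>*\<close>.
\<close>

definition basic_forms :: "nat \<Rightarrow> 'i cochain set" where
  "basic_forms d = {\<omega>. \<forall>S. \<omega> $ S \<noteq> 0 \<longrightarrow> c \<notin> S \<and> card S = d}"

lemma ab_neq_c: "k \<in> {1..n} \<Longrightarrow> a k \<noteq> c" "k \<in> {1..n} \<Longrightarrow> b k \<noteq> c"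
  using ab_range by auto

lemma sum_minus_c:
  fixes g :: "'i \<Rightarrow> 'b::ab_group_add"
  shows "(\<Sum>i\<in>-{c}. g i) = (\<Sum>k=1..n. g (a k) + g (b k))"
proof -
  have "sum g (a ` {1..n} \<union> b ` {1..n}) = sum g (a ` {1..n}) + sum g (b ` {1..n})"
    using a_neq_b by (intro sum.union_disjoint) auto
  also have "\<dots> = (\<Sum>k=1..n. g (a k)) + (\<Sum>k=1..n. g (b k))"
    using a_eq b_eq by (simp add: sum.reindex inj_on_def)
  finally show ?thesis unfolding ab_range by (simp add: sum.distrib)
qed

lemma card_minus_c: "card (- {c}) = 2 * n"
  using sum_minus_c[of "\<lambda>_. 1 :: int"] by simp

lemma card_UNIV: "CARD('i) = 2 * n + 1"
  using card_minus_c card_Suc_Diff1[of UNIV c] by (simp add: Compl_eq_Diff_UNIV)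

lemma linear_Lambda: "linear Lambda"
  unfolding Lambda_def
  by (intro real_vector.linear_compose_sum ballI linear_contract_compose linear_contract)

lemma linear_wedge_Omega: "linear (wedge Omega)"
  by (intro linear_wedge_right real_vector.linear_ident)

lemma inner_wedge_Omega: "wedge Omega \<omega> \<bullet> \<eta> = \<omega> \<bullet> Lambda \<eta>"
  by (simp add: Omega_def Lambda_def wedge_sum_left wedge_assoc inner_sum_left inner_sum_right
      inner_commute[of _ \<eta>] inner_commute[of \<omega>] inner_contract)

lemma homogeneous_Omega: "homogeneous 2 Omega"
  unfolding Omega_def
proof (intro homogeneous_sum)
  fix k assume "k \<in> {1..n}"
  then show "homogeneous 2 (wedge (mon {a k}) (mon {b k}))"
    using a_neq_b[of k k] by (auto simp: wedge_mon homogeneous_def mon_nth)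
qed

text \<open>
  The differential of \<open>z\<^sup>*\<close> is the symplectic form: both are quadratic, and their coefficients at
  \<open>{p, q}\<close> with \<open>p < q\<close> are the structure constants of the bracket. The order of \<open>a k\<close> and
  \<open>b k\<close> enters both sides by the same sign.
\<close>

lemma two_form_c: "two_form br c = Omega"
proof -
  have "two_form br c $ S = Omega $ S" for S
  proof (cases "card S = 2")
    case True
    then obtain p q where "S = {p, q}" "p \<noteq> q" by (meson card_2_iff)
    then obtain p q where S: "S = {p, q}" and pq: "p < q"
      by (metis insert_commute linorder_neqE)
    have "wedge (mon {a k}) (mon {b k}) $ {p, q} =
        axis p 1 $ a k * axis q 1 $ b k - axis p 1 $ b k * axis q 1 $ (a k)"
      if "k \<in> {1..n}" for k
    proof -
      have "shuffle_sign {i} {j} = (if j < i then - 1 else 1)" for i j :: 'i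
      proof -
        have "{(x, y). x \<in> {i} \<and> y \<in> {j} \<and> y < x} = (if j < i then {(i, j)} else {})" by auto
        then show ?thesis by (simp add: shuffle_sign_def)
      qed
      then show ?thesis
        using a_neq_b[OF that that] pq by (auto simp: wedge_mon mon_nth axis_nth_if doubleton_eq_iff)
    qed
    then show ?thesis
      unfolding S by (simp add: two_form_nth[OF pq] br_eq Omega_def sum_component)
  next
    case False
    then show ?thesis
      using homogeneous_two_form homogeneous_Omega unfolding homogeneous_def by metis
  qed
  then show ?thesis by (simp add: vec_eq_iff)
qed

lemma two_form_other: "i \<noteq> c \<Longrightarrow> two_form br i = 0"
  by (simp add: two_form_def br_eq axis_def)

lemma bilinear_br: "bilinear br"
proof -
  have "br = (\<lambda>x y. (\<Sum>k=1..n. x $ a k * y $ b k - x $ b k * y $ a k) *\<^sub>R axis c 1)"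
    by (intro ext br_eq)
  then show ?thesis by (rule ssubst) (rule bilinear_symplectic_form)
qed

lemma br_self: "br x x = 0"
  by (simp add: br_eq mult.commute)

lemma ce_d_eq: "ce_d br \<omega> = wedge Omega (contract c \<omega>)"
proof -
  have "ce_d br \<omega> = (\<Sum>i\<in>UNIV. if i = c then wedge Omega (contract c \<omega>) else 0)"
    unfolding ce_d_eq_formula[OF bilinear_br br_self] ce_d_formula_def
    by (intro sum.cong) (auto simp: two_form_c two_form_other wedge_zero_left)
  then show ?thesis by simp
qed

lemma adjoint_ce_d: "adjoint (ce_d br) = (\<lambda>\<omega>. wedge (mon {c}) (Lambda \<omega>))"
  by (rule adjoint_unique) (simp add: ce_d_eq inner_wedge_Omega inner_contract)

lemma contract_c_eq_0_iff: "contract c \<omega> = 0 \<longleftrightarrow> (\<forall>S. \<omega> $ S \<noteq> 0 \<longrightarrow> c \<notin> S)"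
proof
  assume *: "contract c \<omega> = 0"
  show "\<forall>S. \<omega> $ S \<noteq> 0 \<longrightarrow> c \<notin> S"
  proof (intro allI impI notI)
    fix S assume "\<omega> $ S \<noteq> 0" "c \<in> S"
    then have "contract c \<omega> $ (S - {c}) \<noteq> 0"
      by (simp add: contract_def insert_absorb shuffle_sign_def)
    then show False by (simp add: *)
  qed
qed (auto simp: contract_def vec_eq_iff)

lemma Lambda_support:
  assumes "Lambda \<omega> $ S \<noteq> 0"
  obtains k where "k \<in> {1..n}" "a k \<notin> S" "b k \<notin> S" "\<omega> $ (insert (a k) (insert (b k) S)) \<noteq> 0"
proof -
  obtain k where k: "k \<in> {1..n}" "contract (b k) (contract (a k) \<omega>) $ S \<noteq> 0"
    using assms unfolding Lambda_def sum_component
    by (rule sum.not_neutral_contains_not_neutral)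
  then show ?thesis using that[OF k(1)] by (auto simp: contract_def split: if_splits)
qed

lemma contract_c_Lambda:
  assumes "contract c \<omega> = 0"
  shows "contract c (Lambda \<omega>) = 0"
  unfolding contract_c_eq_0_iff
proof (intro allI impI)
  fix S assume "Lambda \<omega> $ S \<noteq> 0"
  then obtain k where "\<omega> $ (insert (a k) (insert (b k) S)) \<noteq> 0" by (rule Lambda_support)
  then show "c \<notin> S" using assms unfolding contract_c_eq_0_iff by blast
qed

text \<open>
  A basic form is closed, so only \<open>d d\<^sup>*\<close> contributes. Here \<open>d\<^sup>*\<close> multiplies \<open>\<Lambda> \<omega>\<close> by \<open>z\<^sup>*\<close>, and
  \<open>d\<close> replaces \<open>z\<^sup>*\<close> by \<open>\<Omega>\<close>.
\<close>

lemma laplacian_eq: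
  assumes "contract c \<omega> = 0"
  shows "laplacian br \<omega> = wedge Omega (Lambda \<omega>)"
  using contract_c_Lambda[OF assms]
  by (simp add: laplacian_def adjoint_ce_d ce_d_eq contract_wedge_single assms wedge_zero_right
      linear_0[OF linear_Lambda])

subsection \<open>The commutation relation\<close>

lemma subspace_basic_forms: "subspace (basic_forms d)"
proof -
  have "basic_forms d = {\<omega>. \<forall>S. \<not> (c \<notin> S \<and> card S = d) \<longrightarrow> \<omega> $ S = 0}"
    unfolding basic_forms_def by (intro Collect_cong) blast
  then show ?thesis by (auto simp: subspace_def)
qed

lemma contract_c_basic_forms: "\<omega> \<in> basic_forms d \<Longrightarrow> contract c \<omega> = 0"
  by (auto simp: contract_c_eq_0_iff basic_forms_def)

lemma homogeneous_basic_forms: "\<omega> \<in> basic_forms d \<Longrightarrow> homogeneous d \<omega>"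
  by (auto simp: homogeneous_def basic_forms_def)

lemma wedge_Omega_basic_forms: "wedge Omega ` basic_forms d \<subseteq> basic_forms (d + 2)"
proof -
  have Om: "c \<notin> S \<and> card S = 2" if "Omega $ S \<noteq> 0" for S
  proof -
    obtain k where "k \<in> {1..n}" "wedge (mon {a k}) (mon {b k}) $ S \<noteq> 0"
      using \<open>Omega $ S \<noteq> 0\<close> unfolding Omega_def sum_component
      by (rule sum.not_neutral_contains_not_neutral)
    then show ?thesis
      using ab_neq_c[of k] a_neq_b[of k k] by (auto simp: wedge_mon mon_nth split: if_splits)
  qed
  have "c \<notin> S \<and> card S = d + 2" if "\<omega> \<in> basic_forms d" "wedge Omega \<omega> $ S \<noteq> 0" for \<omega> S
  proof -
    obtain T where T: "T \<subseteq> S" "Omega $ T \<noteq> 0" "\<omega> $ (S - T) \<noteq> 0"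
      using wedge_support[OF \<open>wedge Omega \<omega> $ S \<noteq> 0\<close>] .
    then have "c \<notin> S - T" "card (S - T) = d" using that(1) by (auto simp: basic_forms_def)
    moreover have "card ((S - T) \<union> T) = card (S - T) + card T"
      by (rule card_Un_disjoint) auto
    moreover have "(S - T) \<union> T = S" using T(1) by blast
    ultimately show ?thesis using Om[OF T(2)] by auto
  qed
  then have "wedge Omega \<omega> \<in> basic_forms (d + 2)" if "\<omega> \<in> basic_forms d" for \<omega>
    using that unfolding basic_forms_def[of "d + 2"] by blast
  then show ?thesis by blast
qed

lemma Lambda_basic_forms: "Lambda ` basic_forms (d + 2) \<subseteq> basic_forms d"
proof -
  have "c \<notin> S \<and> card S = d" if "\<omega> \<in> basic_forms (d + 2)" "Lambda \<omega> $ S \<noteq> 0" for \<omega> S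
  proof -
    obtain k where "k \<in> {1..n}" "a k \<notin> S" "b k \<notin> S" "\<omega> $ (insert (a k) (insert (b k) S)) \<noteq> 0"
      using Lambda_support[OF \<open>Lambda \<omega> $ S \<noteq> 0\<close>] by blast
    moreover from this have "c \<notin> insert (a k) (insert (b k) S)"
      "card (insert (a k) (insert (b k) S)) = d + 2"
      using that(1) unfolding basic_forms_def by blast+
    ultimately show ?thesis using a_neq_b[of k k] by simp
  qed
  then have "Lambda \<omega> \<in> basic_forms d" if "\<omega> \<in> basic_forms (d + 2)" for \<omega>
    using that unfolding basic_forms_def[of d] by blast
  then show ?thesis by blast
qed

lemma contract_Omega:
  assumes "k \<in> {1..n}"
  shows "contract (a k) Omega = mon {b k}" "contract (b k) Omega = - mon {a k}"
proof -
  have "contract (a k) Omega = (\<Sum>l=1..n. if l = k then mon {b l} else 0)"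
    unfolding Omega_def contract_sum
  proof (intro sum.cong refl)
    fix l assume "l \<in> {1..n}"
    then show "contract (a k) (wedge (mon {a l}) (mon {b l})) = (if l = k then mon {b l} else 0)"
      using assms a_eq[of k l] a_neq_b[of k l]
      by (auto simp: contract_wedge_single contract_mon_single wedge_zero_right)
  qed
  then show "contract (a k) Omega = mon {b k}" using assms by simp
  have "contract (b k) Omega = (\<Sum>l=1..n. if l = k then - mon {a l} else 0)"
    unfolding Omega_def contract_sum
  proof (intro sum.cong refl)
    fix l assume "l \<in> {1..n}"
    then show "contract (b k) (wedge (mon {a l}) (mon {b l})) = (if l = k then - mon {a l} else 0)"
      using assms b_eq[of k l] a_neq_b[of l k]
      by (auto simp: contract_wedge_single contract_mon_single wedge_zero_right)
  qed
  then show "contract (b k) Omega = - mon {a k}" using assms by simp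
qed

text \<open>
  The commutation relation of \<open>sl\<^sub>2\<close>. Each contraction is an odd derivation, and contracting \<open>\<Omega>\<close>
  with \<open>a k\<close> and \<open>b k\<close> leaves the partner covectors; what remains besides \<open>\<Omega> \<and> \<Lambda> \<omega>\<close> is one
  copy of \<open>\<omega>\<close> for each \<open>k\<close> minus the number operator.
\<close>

lemma Lambda_wedge_Omega:
  assumes "\<omega> \<in> basic_forms d"
  shows "Lambda (wedge Omega \<omega>) = wedge Omega (Lambda \<omega>) + (real n - real d) *\<^sub>R \<omega>"
proof -
  have neg: "wedge (- \<alpha>) \<beta> = - wedge \<alpha> \<beta>" for \<alpha> \<beta> :: "'i cochain"
    using wedge_scale_left[of "-1" \<alpha> \<beta>] by simp
  let ?N = "\<lambda>i. wedge (mon {i}) (contract i \<omega>)"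
  have "contract (b k) (contract (a k) (wedge Omega \<omega>)) =
      \<omega> - (?N (a k) + ?N (b k)) + wedge Omega (contract (b k) (contract (a k) \<omega>))"
    if k: "k \<in> {1..n}" for k
    by (simp add: contract_wedge[OF homogeneous_Omega] contract_Omega[OF k]
        linear_add[OF linear_contract] contract_wedge_single neg)
  then have "Lambda (wedge Omega \<omega>) =
      real n *\<^sub>R \<omega> - (\<Sum>k=1..n. ?N (a k) + ?N (b k)) + wedge Omega (Lambda \<omega>)"
    by (simp add: Lambda_def sum.distrib sum_subtractf wedge_sum_right sum_constant_scaleR
        del: sum_constant)
  also have "(\<Sum>k=1..n. ?N (a k) + ?N (b k)) = sum ?N (- {c})" by (rule sum_minus_c[symmetric])
  also have "\<dots> = sum ?N UNIV"
    using contract_c_basic_forms[OF assms]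
    by (intro sum.mono_neutral_left) (auto simp: wedge_zero_right)
  also have "\<dots> = real d *\<^sub>R \<omega>" by (rule sum_wedge_contract[OF homogeneous_basic_forms[OF assms]])
  finally show ?thesis by (simp add: scaleR_left_diff_distrib)
qed

subsection \<open>Multiplicities of the eigenvalues\<close>

lemma dim_basic_forms: "dim (basic_forms d) = (2 * n) choose d"
proof -
  have "basic_forms d = {\<omega>. \<forall>S. S \<notin> {S. S \<subseteq> - {c} \<and> card S = d} \<longrightarrow> \<omega> $ S = 0}"
    unfolding basic_forms_def by (intro Collect_cong) blast
  then have "dim (basic_forms d) = card {S. S \<subseteq> - {c} \<and> card S = d}"
    using dim_substandard_cart[of "{S. S \<subseteq> - {c} \<and> card S = d}", where 'a=real]
    by (simp add: dim_vec_eq)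
  then show ?thesis using n_subsets[of "- {c}" d] card_minus_c by simp
qed

text \<open>
  The forms without \<open>z\<^sup>*\<close> are a subalgebra that contains \<open>H\<^sup>1\<close>, since \<open>z\<close> is a bracket (this
  needs a pair \<open>a 1, b 1\<close>, that is \<open>n \<ge> 1\<close>). Conversely, every monomial without \<open>z\<^sup>*\<close> is a product
  of coordinate covectors in \<open>H\<^sup>1\<close>.
\<close>

lemma basic_cochains_eq: "basic_cochains br = {\<omega>. contract c \<omega> = 0}"
proof
  have "axis c 1 \<in> span {br x y | x y. True}"
  proof -
    have "br (axis (a 1) 1) (axis (b 1) 1) = axis c 1"
    proof -
      have "(\<Sum>k=1..n. axis (a 1) 1 $ a k * axis (b 1) 1 $ b k -
         axis (a 1) 1 $ b k * axis (b 1) (1::real) $ a k) = (\<Sum>k=1..n. if k = 1 then 1 else (0::real))"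
      proof (intro sum.cong refl)
        fix k assume "k \<in> {1..n}"
        then show "axis (a 1) 1 $ a k * axis (b 1) 1 $ b k -
            axis (a 1) 1 $ b k * axis (b 1) (1::real) $ a k = (if k = 1 then 1 else (0::real))"
          using n a_eq[of k 1] b_eq[of k 1] a_neq_b[of 1 k] by (auto simp: axis_nth_if)
      qed
      then show ?thesis using n by (simp add: br_eq)
    qed
    then show ?thesis by (metis (mono_tags, lifting) mem_Collect_eq span_base)
  qed
  then have cov: "contract c (covector \<phi>) = 0" if "\<phi> \<in> H1 br" for \<phi>
    using that by (auto simp: H1_def covector_def contract_sum contract_scale contract_mon_single
        if_distrib[where f="scaleR _"] cong: if_cong)
  have "c \<notin> S" if "\<forall>S. \<omega> $ S \<noteq> 0 \<longrightarrow> c \<notin> S" "\<forall>S. \<eta> $ S \<noteq> 0 \<longrightarrow> c \<notin> S" "wedge \<omega> \<eta> $ S \<noteq> 0"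
    for \<omega> \<eta> :: "'i cochain" and S
    using wedge_support[OF that(3)] that(1,2) by (metis DiffI)
  then have "contract c (wedge \<omega> \<eta>) = 0" if "contract c \<omega> = 0" "contract c \<eta> = 0" for \<omega> \<eta>
    using that unfolding contract_c_eq_0_iff by blast
  then have "ext_subalgebra {\<omega>. contract c \<omega> = 0}"
    by (auto simp: ext_subalgebra_def subspace_def linear_add[OF linear_contract] contract_scale
        contract_zero contract_mon)
  then show "basic_cochains br \<subseteq> {\<omega>. contract c \<omega> = 0}"
    unfolding basic_cochains_def by (intro hull_minimal) (auto simp: cov)
next
  have "\<omega> \<in> A" if A: "ext_subalgebra A" "covector ` H1 br \<subseteq> A" and \<omega>: "contract c \<omega> = 0" for A \<omega>
  proof -
    have sub: "subspace A" and one: "mon {} \<in> A"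
      and wedge: "\<And>\<alpha> \<beta>. \<alpha> \<in> A \<Longrightarrow> \<beta> \<in> A \<Longrightarrow> wedge \<alpha> \<beta> \<in> A"
      using A by (auto simp: ext_subalgebra_def)
    have gen: "mon {i} \<in> A" if "i \<noteq> c" for i
    proof -
      have lin: "linear (\<lambda>v :: 'i vect. v $ i)" by (simp add: linear_iff)
      have "span {br x y | x y. True} \<subseteq> {v. v $ i = 0}"
        using that by (intro span_minimal) (auto simp: br_eq axis_def subspace_def)
      then have "(\<lambda>v. v $ i) \<in> H1 br" using lin by (simp add: H1_def)
      moreover have "covector (\<lambda>v. v $ i) = mon {i}"
        by (simp add: covector_def axis_def if_distrib[where f="\<lambda>c. c *\<^sub>R _"] cong: if_cong)
      ultimately show ?thesis using A(2) by (metis image_subset_iff)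
    qed
    have mon: "mon S \<in> A" if "c \<notin> S" for S
      using finite[of S] that
    proof (induction S rule: finite_induct)
      case (insert i S)
      then have "shuffle_sign {i} S *\<^sub>R wedge (mon {i}) (mon S) \<in> A"
        by (intro subspace_scale[OF sub] wedge gen) auto
      also have "shuffle_sign {i} S *\<^sub>R wedge (mon {i}) (mon S) = mon (insert i S)"
        using insert.hyps by (simp add: wedge_mon)
      finally show ?case .
    qed (rule one)
    have "(\<Sum>S\<in>UNIV. \<omega> $ S *\<^sub>R mon S) \<in> A"
    proof (rule subspace_sum[OF sub])
      fix S
      show "\<omega> $ S *\<^sub>R mon S \<in> A"
      proof (cases "c \<in> S")
        case True
        then have "\<omega> $ S = 0" using \<omega> unfolding contract_c_eq_0_iff by blast
        then show ?thesis using subspace_0[OF sub] by simp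
      qed (intro subspace_scale[OF sub] mon)
    qed
    then show ?thesis using cochain_expand[of \<omega>] by simp
  qed
  then show "{\<omega>. contract c \<omega> = 0} \<subseteq> basic_cochains br"
    unfolding basic_cochains_def hull_def by blast
qed

lemma basic_eigenspace_eq:
  "basic_eigenspace br d \<mu> = {\<omega> \<in> basic_forms d. wedge Omega (Lambda \<omega>) = \<mu> *\<^sub>R \<omega>}"
proof -
  have "\<omega> \<in> basic_cochains br \<and> homogeneous d \<omega> \<longleftrightarrow> \<omega> \<in> basic_forms d" for \<omega>
    by (auto simp: basic_cochains_eq contract_c_eq_0_iff homogeneous_def basic_forms_def)
  then have "basic_eigenspace br d \<mu> = {\<omega> \<in> basic_forms d. laplacian br \<omega> = \<mu> *\<^sub>R \<omega>}"
    unfolding basic_eigenspace_def by blast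
  also have "\<dots> = {\<omega> \<in> basic_forms d. wedge Omega (Lambda \<omega>) = \<mu> *\<^sub>R \<omega>}"
    using laplacian_eq[OF contract_c_basic_forms] by (intro Collect_cong conj_cong refl) simp
  finally show ?thesis .
qed

lemma dim_basic_eigenspace_step:
  "real (dim (basic_eigenspace br (d + 2) \<mu>)) =
    real (dim (basic_eigenspace br d (\<mu> - (real n - real d)))) +
    (if \<mu> = 0 then primitive_dim n (d + 2) else 0)"
  using dim_eigenspace_shift[OF linear_wedge_Omega linear_Lambda subspace_basic_forms
      subspace_basic_forms wedge_Omega_basic_forms Lambda_basic_forms inner_wedge_Omega
      Lambda_wedge_Omega, of d]
  unfolding basic_eigenspace_eq by (simp add: dim_basic_forms primitive_dim_def)

lemma dim_basic_eigenspace_low: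
  assumes "d < 2"
  shows "real (dim (basic_eigenspace br d \<mu>)) = (if \<mu> = 0 then primitive_dim n d else 0)"
proof -
  have "Lambda \<omega> = 0" if "\<omega> \<in> basic_forms d" for \<omega>
  proof -
    have "Lambda \<omega> $ S = 0" for S
    proof (rule ccontr)
      assume "Lambda \<omega> $ S \<noteq> 0"
      then obtain k where "k \<in> {1..n}" "\<omega> $ (insert (a k) (insert (b k) S)) \<noteq> 0"
        using Lambda_support by blast
      moreover have "card {a k, b k} \<le> card (insert (a k) (insert (b k) S))"
        by (rule card_mono) auto
      ultimately show False
        using that assms a_neq_b[of k k] by (auto simp: basic_forms_def)
    qed
    then show ?thesis by (simp add: vec_eq_iff)
  qed
  then have "basic_eigenspace br d \<mu> = (if \<mu> = 0 then basic_forms d else {0})"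
    using subspace_0[OF subspace_basic_forms, of d]
    unfolding basic_eigenspace_eq by (auto simp: wedge_zero_right linear_0[OF linear_Lambda])
  then show ?thesis using assms by (simp add: dim_basic_forms primitive_dim_def)
qed

text \<open>
  Unfolding the step: passing from degree \<open>d\<close> to \<open>d + 2\<close> sends the eigenvalue of string position
  \<open>r\<close> to that of position \<open>r + 1\<close>, and the new primitive forms enter at position \<open>0\<close>. Above the
  middle degree the summands are virtual multiplicities, whose sum is still the dimension.
\<close>

lemma dim_basic_eigenspace:
  "real (dim (basic_eigenspace br d \<mu>)) =
    (\<Sum>r\<le>d div 2. if \<mu> = string_eigenvalue n d r then primitive_dim n (d - 2 * r) else 0)"
proof (induction d arbitrary: \<mu> rule: nat_less_induct)
  case (1 d)
  show ?case
  proof (cases "d < 2")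
    case True
    then show ?thesis using dim_basic_eigenspace_low[OF True] by (simp add: string_eigenvalue_def)
  next
    case False
    then obtain e where d: "d = e + 2" by (metis add.commute le_Suc_ex not_less)
    have "string_eigenvalue n d (Suc r) = string_eigenvalue n e r + (real n - real e)" for r
      by (simp add: d string_eigenvalue_def algebra_simps)
    then have eq: "\<mu> = string_eigenvalue n d (Suc r) \<longleftrightarrow> \<mu> - (real n - real e) = string_eigenvalue n e r" for r
      by auto
    have shift: "d - 2 * Suc r = e - 2 * r" for r using d by simp
    have "real (dim (basic_eigenspace br d \<mu>)) = (\<Sum>r\<le>e div 2.
        if \<mu> - (real n - real e) = string_eigenvalue n e r then primitive_dim n (e - 2 * r) else 0) +
        (if \<mu> = 0 then primitive_dim n d else 0)"
      using dim_basic_eigenspace_step[of e \<mu>] 1 d by simp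
    also have "\<dots> = (\<Sum>r\<le>Suc (e div 2).
        if \<mu> = string_eigenvalue n d r then primitive_dim n (d - 2 * r) else 0)"
      unfolding sum.atMost_Suc_shift eq shift by (simp add: string_eigenvalue_def)
    finally show ?thesis by (simp add: d)
  qed
qed

lemma sum_basic_eigenvalues:
  fixes f :: "real \<Rightarrow> complex"
  shows "(\<Sum>\<mu>\<in>basic_eigenvalues br d. of_nat (dim (basic_eigenspace br d \<mu>)) * f \<mu>) =
    (\<Sum>r\<le>d div 2. of_real (primitive_dim n (d - 2 * r)) * f (string_eigenvalue n d r))"
proof -
  \<comment> \<open>A string value need not be an eigenvalue: its virtual multiplicities may sum to zero.\<close>
  define F where "F = basic_eigenvalues br d \<union> string_eigenvalue n d ` {..d div 2}"
  have F: "finite F"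
    using finite_basic_eigenvalues[OF bilinear_br br_self] by (simp add: F_def)
  have "dim (basic_eigenspace br d \<mu>) = 0" if "\<mu> \<notin> basic_eigenvalues br d" for \<mu>
    using that by (auto simp: basic_eigenvalues_def)
  then have "(\<Sum>\<mu>\<in>basic_eigenvalues br d. of_nat (dim (basic_eigenspace br d \<mu>)) * f \<mu>) =
      (\<Sum>\<mu>\<in>F. of_real (real (dim (basic_eigenspace br d \<mu>))) * f \<mu>)"
    using F by (intro sum.mono_neutral_cong_left) (auto simp: F_def)
  also have "\<dots> = (\<Sum>\<mu>\<in>F. \<Sum>r\<le>d div 2. if \<mu> = string_eigenvalue n d r
      then of_real (primitive_dim n (d - 2 * r)) * f \<mu> else 0)"
    unfolding dim_basic_eigenspace of_real_sum sum_distrib_right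
    by (intro sum.cong refl) auto
  also have "\<dots> = (\<Sum>r\<le>d div 2. \<Sum>\<mu>\<in>F. if \<mu> = string_eigenvalue n d r
      then of_real (primitive_dim n (d - 2 * r)) * f \<mu> else 0)"
    by (rule sum.swap)
  also have "\<dots> = (\<Sum>r\<le>d div 2. of_real (primitive_dim n (d - 2 * r)) * f (string_eigenvalue n d r))"
    using F by (intro sum.cong) (auto simp: F_def)
  finally show ?thesis .
qed

lemma basic_partition_function_eq:
  "basic_partition_function br s t =
    (\<Sum>k=0..n. \<Sum>m=0..n - k. \<Sum>j=0..min m (n - k - m).
       of_real (heisenberg_multiplicity n k j) *
       s ^ ((m - j) * (n - k - m - j + 1)) * t ^ (2 * m + k))"
proof -
  have "basic_partition_function br s t = (\<Sum>d\<le>2 * n + 1. (\<Sum>r\<le>d div 2.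
      of_real (primitive_dim n (d - 2 * r)) * real_exp_power s (string_eigenvalue n d r)) * t ^ d)"
    unfolding basic_partition_function_def card_UNIV sum_distrib_right[symmetric]
      sum_basic_eigenvalues ..
  also have "\<dots> = (\<Sum>k=0..n. \<Sum>m=0..n - k. \<Sum>j=0..min m (n - k - m).
       of_real (heisenberg_multiplicity n k j) *
       s ^ ((m - j) * (n - k - m - j + 1)) * t ^ (2 * m + k))"
    by (rule sum_over_strings) (rule real_exp_power_of_nat)
  finally show ?thesis .
qed

end

section \<open>The Heisenberg algebra in coordinates\<close>

text \<open>
  The brackets of basis vectors determine the bracket, which is therefore the symplectic form on the
  \<open>y\<close>-coordinates times \<open>z\<close>.
\<close>

lemma heisenberg_frame_exists:
  assumes n: "n \<ge> 1" and h: "heisenberg n br y z"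
  obtains a b c where "heisenberg_frame n br a b c"
proof -
  have lie: "lie_bracket br" and z: "z \<in> Basis" and y: "bij_betw y {1..2 * n} (Basis - {z})"
    using h by (auto simp: heisenberg_def)
  have yy: "br (y (2 * k - 1)) (y (2 * k)) = z" if "k \<in> {1..n}" for k
    using h that unfolding heisenberg_def by blast
  have y0: "br (y p) (y q) = 0" if "p \<in> {1..2 * n}" "q \<in> {1..2 * n}" "p < q"
     "\<not> (\<exists>k\<in>{1..n}. p = 2 * k - 1 \<and> q = 2 * k)" for p q
    using h that unfolding heisenberg_def by blast
  have yz: "br (y p) z = 0" if "p \<in> {1..2 * n}" for p
    using h that unfolding heisenberg_def by blast
  have bil: "bilinear br" and alt: "br x x = 0" for x
    using lie by (auto simp: lie_bracket_def)
  have anti: "br u v = - br v u" for u v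
  proof -
    have "br (u + v) (u + v) = br u u + br u v + (br v u + br v v)"
      by (simp add: bilinear_ladd[OF bil] bilinear_radd[OF bil])
    then show ?thesis by (simp add: alt eq_neg_iff_add_eq_0)
  qed
  obtain c where c: "z = axis c 1" using z by (auto simp: Basis_vec_def)
  have "\<forall>p\<in>{1..2 * n}. \<exists>i. y p = axis i 1"
    using bij_betwE[OF y] by (auto simp: Basis_vec_def)
  then obtain e where e: "\<And>p. p \<in> {1..2 * n} \<Longrightarrow> y p = axis (e p) 1" by metis
  have e_inj: "e p = e q \<longleftrightarrow> p = q" if "p \<in> {1..2 * n}" "q \<in> {1..2 * n}" for p q
    using inj_on_eq_iff[OF bij_betw_imp_inj_on[OF y] that] e[OF that(1)] e[OF that(2)]
    by (auto simp: axis_eq_axis)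
  have coord: "y p $ e q = (if p = q then 1 else 0)"
    if "p \<in> {1..2 * n}" "q \<in> {1..2 * n}" for p q
    unfolding e[OF that(1)] axis_nth_if using e_inj[OF that] by auto
  have e_range: "e ` {1..2 * n} = - {c}"
  proof -
    have "i \<in> e ` {1..2 * n} \<longleftrightarrow> axis i (1::real) \<in> y ` {1..2 * n}" for i
      using e by (auto simp: image_iff axis_eq_axis)
    moreover have "axis i (1::real) \<in> y ` {1..2 * n} \<longleftrightarrow> i \<noteq> c" for i
      unfolding bij_betw_imp_surj_on[OF y] by (auto simp: c axis_eq_axis)
    ultimately show ?thesis by auto
  qed
  define a b where "a k = e (2 * k - 1)" and "b k = e (2 * k)" for k
  have in_range: "2 * k - 1 \<in> {1..2 * n}" "2 * k \<in> {1..2 * n}" if "k \<in> {1..n}" for k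
    using that by auto
  let ?B = "\<lambda>x y. (\<Sum>k=1..n. x $ a k * y $ b k - x $ b k * y $ a k) :: real"
  have Bc: "?B x (axis c 1) = 0" for x :: "'a vect"
  proof -
    have "c \<noteq> e p" if "p \<in> {1..2 * n}" for p using e_range that by blast
    then have "a k \<noteq> c" "b k \<noteq> c" if "k \<in> {1..n}" for k
      using in_range[OF that] unfolding a_def b_def by metis+
    then show ?thesis by (intro sum.neutral) (simp add: axis_nth_if)
  qed
  have Banti: "?B x x' = - ?B x' x" for x x' :: "'a vect"
    by (simp add: algebra_simps flip: sum_negf)
  have Bbil: "bilinear (\<lambda>x y. ?B x y *\<^sub>R z)"
    by (rule bilinear_symplectic_form)
  have lt: "br (y p) (y q) = ?B (y p) (y q) *\<^sub>R z"
    if p: "p \<in> {1..2 * n}" and q: "q \<in> {1..2 * n}" and pq: "p < q" for p q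
  proof -
    \<comment> \<open>As \<open>p < q\<close>, the subtracted product of each summand vanishes.\<close>
    have B: "?B (y p) (y q) = (\<Sum>k=1..n. if p = 2 * k - 1 \<and> q = 2 * k then 1 else 0)"
    proof (intro sum.cong refl)
      fix k assume k: "k \<in> {1..n}"
      have "2 * k \<noteq> 2 * k - 1" using k by auto
      then show "y p $ a k * y q $ b k - y p $ b k * y q $ a k =
          (if p = 2 * k - 1 \<and> q = 2 * k then 1 else 0)"
        unfolding a_def b_def coord[OF p in_range(1)[OF k]] coord[OF p in_range(2)[OF k]]
          coord[OF q in_range(1)[OF k]] coord[OF q in_range(2)[OF k]]
        using pq by auto
    qed
    show ?thesis
    proof (cases "\<exists>k\<in>{1..n}. p = 2 * k - 1 \<and> q = 2 * k")
      case True
      then obtain k where k: "k \<in> {1..n}" "p = 2 * k - 1" "q = 2 * k" by blast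
      have "?B (y p) (y q) = (\<Sum>l=1..n. if l = k then 1 else 0)"
        unfolding B using k by (intro sum.cong) auto
      then show ?thesis using yy[OF k(1)] k by simp
    next
      case False
      then have "?B (y p) (y q) = 0" unfolding B by (intro sum.neutral) auto
      then show ?thesis using y0[OF p q pq False] by simp
    qed
  qed
  have "br = (\<lambda>x y. ?B x y *\<^sub>R z)"
  proof (rule bilinear_eq_stdbasis[OF bil Bbil])
    fix u v :: "'a vect"
    assume uv: "u \<in> Basis" "v \<in> Basis"
    have cases: "u = z \<or> (\<exists>p\<in>{1..2 * n}. u = y p)" if "u \<in> Basis" for u
      using that bij_betw_imp_surj_on[OF y] by blast
    have z0: "br u z = ?B u z *\<^sub>R z" if "u \<in> Basis" for u
    proof -
      have "br u z = 0" using cases[OF that] yz alt by auto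
      moreover have "?B u z = 0" unfolding c by (rule Bc)
      ultimately show ?thesis by (simp only: scaleR_zero_left)
    qed
    consider "v = z" | "u = z" | p q where "p \<in> {1..2 * n}" "u = y p" "q \<in> {1..2 * n}" "v = y q"
      using cases uv by metis
    then show "br u v = ?B u v *\<^sub>R z"
    proof cases
      case 1
      then show ?thesis using z0 uv by blast
    next
      case 2
      then show ?thesis using z0[OF uv(2)] anti[of u v] Banti[of u v] by (metis scaleR_minus_left)
    next
      case 3
      consider "p < q" | "p = q" | "q < p" by linarith
      then show ?thesis
      proof cases
        case 1
        with 3 show ?thesis using lt by blast
      next
        case 2
        with 3 show ?thesis using alt by (simp add: mult.commute)
      next
        assume "q < p"
        with 3 show ?thesis
          using lt[of q p] anti[of u v] Banti[of u v] by (metis scaleR_minus_left)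
      qed
    qed
  qed
  then have br: "br x x' = ?B x x' *\<^sub>R axis c 1" for x x' by (metis c)
  have "heisenberg_frame n br a b c"
  proof
    show "a ` {1..n} \<union> b ` {1..n} = - {c}"
    proof -
      have "{1..2 * n} = (\<lambda>k. 2 * k - 1) ` {1..n} \<union> (\<lambda>k. 2 * k) ` {1..n}"
      proof -
        have "p \<in> (\<lambda>k. 2 * k - 1) ` {1..n} \<union> (\<lambda>k. 2 * k) ` {1..n}" if "p \<in> {1..2 * n}" for p
        proof (cases "even p")
          case True
          then obtain k where "p = 2 * k" by blast
          then show ?thesis using that by auto
        next
          case False
          then obtain k where "p = 2 * k + 1" using oddE by blast
          then have "p = 2 * Suc k - 1" "Suc k \<in> {1..n}" using that by auto
          then show ?thesis by blast
        qed
        then show ?thesis using in_range by blast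
      qed
      then show ?thesis unfolding e_range[symmetric] by (simp add: image_Un image_image a_def b_def)
    qed
  next
    fix k l assume kl: "k \<in> {1..n}" "l \<in> {1..n}"
    show "a k = a l \<longleftrightarrow> k = l" "b k = b l \<longleftrightarrow> k = l" "a k \<noteq> b l"
      using e_inj[of "2 * k - 1" "2 * l - 1"] e_inj[of "2 * k" "2 * l"] e_inj[of "2 * k - 1" "2 * l"]
        in_range[OF kl(1)] in_range[OF kl(2)] kl unfolding a_def b_def
      by (simp, linarith?, simp, simp, presburger)
  qed (use n br in auto)
  then show ?thesis by (rule that)
qed

theorem theorem44:
  fixes n :: nat
    and br :: "'i::{finite,linorder} bracket"
    and y :: "nat \<Rightarrow> 'i vect" and z :: "'i vect"
    and s t :: complex
  assumes "n \<ge> 1"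
    and "heisenberg n br y z"
  shows "basic_partition_function br s t =
    (\<Sum>k=0..n. \<Sum>m=0..n - k. \<Sum>j=0..min m (n - k - m).
       of_real (heisenberg_multiplicity n k j) *
       s ^ ((m - j) * (n - k - m - j + 1)) * t ^ (2 * m + k))"
proof -
  obtain a b c where "heisenberg_frame n br a b c"
    using heisenberg_frame_exists[OF assms] .
  then show ?thesis by (rule heisenberg_frame.basic_partition_function_eq)
qed

end
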